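(* Let $k\in\mathbb{Z}\setminus\{0\}$. The number $-ikc$ is an eigenvalue of the linearized two phase fluid Euler equation if there exists a nontrivial solution of the linearized system of the single Fourier mode form $$(z,Y,\Gamma,P)=(\mathfrak{z},\mathcal{Y}(x_2),\gamma(x_2),\mathcal{P}(x_2))\,e^{ik(x_1-ct)}.$$ This is equivalent to the existence of a nontrivial solution $(\mathfrak{z},\mathcal{Y}_2,\gamma,c)$, with $\mathcal{Y}_{2\pm}(\pm h_\pm)=0$ (and $\mathcal{Y}_{2+}(0)=\mathcal{Y}_{2-}(0)=:\mathcal{Y}_2(0)$), of $$\gamma_\pm(x_2)=\frac{\rho_\mp\,(U_-(0)-U_+(0))}{|k|\big(\rho_-\tanh(|k|h_+)+\rho_+\tanh(|k|h_-)\big)}\,\frac{\cosh(|k|(x_2\mp h_\pm))}{\cosh(|k|h_\pm)}\,ik\mathfrak{z},$$ $$ik\Big(\frac{\rho_+U_+(0)\tanh(|k|h_-)+\rho_-U_-(0)\tanh(|k|h_+)}{\rho_-\tanh(|k|h_+)+\rho_+\tanh(|k|h_-)}-c\Big)\mathfrak{z}=\mathcal{Y}_2(0),$$ $$-\mathcal{Y}_2''+\Big(\frac{U''}{U-c}+k^2\Big)\mathcal{Y}_2+\frac{U''}{U-c}\gamma'=0\quad\text{on }(-h_-,0)\text{ and on }(0,h_+),$$ $$\big(g[\![\rho]\!]-\sigma k^2\big)\mathfrak{z}=\frac{i}{k}\Big(-[\![\rho(U-c)\mathcal{Y}_2']\!]+[\![\rho U']\!]\,\mathcal{Y}_2(0)-k^2[\![U]\!]\,\rho_+\gamma_+(0)+[\![\rho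 U'\gamma']\!]\Big).$$
   Context: Constants: $g>0$, $\sigma\ge0$, $\rho_\pm>0$, $h_\pm>0$. $\mathbb{T}=\mathbb{R}/2\pi\mathbb{Z}$; $\Omega^+=\mathbb{T}\times(0,h_+)$, $\Omega^-=\mathbb{T}\times(-h_-,0)$, $\Omega=\Omega^+\cup\Omega^-$, $S=\mathbb{T}\times\{0\}$. For $f$ on $\Omega$, $f_\pm$ is its restriction to $\Omega^\pm$, and $[\![f]\!]=(f_+-f_-)|_{x_2=0}$; $\rho=\rho_\pm$ in $\Omega^\pm$. The background is a shear flow $(U(x_2),0)$ with flat interface $S$, where $U=U_+$ for $x_2>0$ and $U=U_-$ for $x_2<0$, $U_+$ and $U_-$ being smooth real functions on $[0,h_+]$ and $[-h_-,0]$; $U$ may jump at $0$. Primes denote $d/dx_2$. The linearized two phase Euler equation at this shear flow is the following system for $z=z(t,x_1)$ (interface variation) and for $Y=(Y_1,Y_2)$, $\Gamma$, $P$ on $\Omega$. The field $Y$ is divergence free in $\Omega^\pm$, $Y_2=0$ on $x_2=\pm h_\pm$, $Y_{2+}=Y_{2-}$ on $S$, and $$Y_t+UY_{x_1}+U'Y_2\mathbf{e}_1+U\nabla\Gamma_{x_1}+\Gamma_{x_2}U'\mathbf{e}_1+\nabla P=0\ \text{ in }\Omega,\qquad z_t+U_\pm(0)z_{x_1}=Y_2+\partial_{x_2}\Gamma_\pm\ \text{ on }S,$$ where $\Delta\Gamma=0$ in $\Omega$, $\partial_{x_2}\Gamma_\pm=0$ on $x_2=\pm h_\pm$, $\Gamma_\pm|_S=\rho_\pm^{-1}(U_-(0)-U_+(0))\,\partial_{x_1}\mathcal{N}^{-1}z$,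 and $$-\Delta P=2U'(\partial_{x_1}Y_2+\Gamma_{x_1x_2})\ \text{in }\Omega,\quad \partial_{x_2}P=0\text{ on }x_2=\pm h_\pm,\quad \rho_+P_+-\rho_-P_-=g(\rho_+-\rho_-)z+\sigma z_{x_1x_1}\text{ on }S.$$ Here $\mathcal{N}$ is the Fourier multiplier on $\mathbb{T}$ with symbol $\widehat{\mathcal{N}}(k)=|k|\big(\rho_+^{-1}\tanh(|k|h_+)+\rho_-^{-1}\tanh(|k|h_-)\big)$.
   Formalization: The quotient U''/(U-c) is undefined at points where U=c (e.g. U=0, c=0), and c is not restricted; at those points only, the equation for Y_2 is read after multiplying by U-c, i.e. as U''(Y_2+γ')=0. *)

theory Defs
  imports "HOL-Analysis.Analysis"
begin

section \<open>Two phase geometry\<close>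

text \<open>A field on \<open>\<Omega>\<close> is a family indexed by \<open>side\<close>: \<open>f Upper\<close> is \<open>f\<^sub>+\<close> and \<open>f Lower\<close> is
  \<open>f\<^sub>-\<close>, so that each has its own one-sided values and derivatives on the interface \<open>x2 = 0\<close>.
  Only values on the closed strips are ever used.\<close>

datatype side = Upper | Lower

fun opposite :: "side \<Rightarrow> side" where
  "opposite Upper = Lower"
| "opposite Lower = Upper"

definition jump :: "(side \<Rightarrow> 'a::ab_group_add) \<Rightarrow> 'a" where
  "jump f = f Upper - f Lower"

fun wall :: "(side \<Rightarrow> real) \<Rightarrow> side \<Rightarrow> real" where
  "wall h Upper = h Upper"
| "wall h Lower = - h Lower"

fun closed_layer :: "(side \<Rightarrow> real) \<Rightarrow> side \<Rightarrow> real set" where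
  "closed_layer h Upper = {0..h Upper}"
| "closed_layer h Lower = {- h Lower..0}"

fun open_layer :: "(side \<Rightarrow> real) \<Rightarrow> side \<Rightarrow> real set" where
  "open_layer h Upper = {0<..<h Upper}"
| "open_layer h Lower = {- h Lower<..<0}"


section \<open>Derivatives up to the boundary\<close>

text \<open>\<open>I\<close> is a nondegenerate closed interval; at its end points the derivative is one-sided.\<close>

definition der :: "real set \<Rightarrow> (real \<Rightarrow> 'a::real_normed_vector) \<Rightarrow> real \<Rightarrow> 'a" where
  "der I f x = vector_derivative f (at x within I)"

definition smooth_on :: "real set \<Rightarrow> (real \<Rightarrow> 'a::real_normed_vector) \<Rightarrow> bool" where
  "smooth_on I f \<longleftrightarrow> (\<forall>n. (der I ^^ n) f differentiable_on I)"

definition C2_on :: "real set \<Rightarrow> (real \<Rightarrow> 'a::real_normed_vector) \<Rightarrow> bool" where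
  "C2_on I f \<longleftrightarrow> f differentiable_on I \<and> der I f differentiable_on I \<and>
     continuous_on I (der I (der I f))"

text \<open>Arguments of a field are \<open>t\<close>, \<open>x1\<close>, \<open>x2\<close>, with \<open>x2\<close> ranging over \<open>I\<close>.\<close>

type_synonym field3 = "real \<Rightarrow> real \<Rightarrow> real \<Rightarrow> complex"

definition Dt :: "field3 \<Rightarrow> field3" where
  "Dt f t x1 x2 = vector_derivative (\<lambda>s. f s x1 x2) (at t)"

definition D1 :: "field3 \<Rightarrow> field3" where
  "D1 f t x1 x2 = vector_derivative (\<lambda>s. f t s x2) (at x1)"

definition D2 :: "real set \<Rightarrow> field3 \<Rightarrow> field3" where
  "D2 I f t x1 x2 = der I (f t x1) x2"

primrec Ck :: "nat \<Rightarrow> real set \<Rightarrow> field3 \<Rightarrow> bool" where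
  "Ck 0 I f \<longleftrightarrow> continuous_on (UNIV \<times> UNIV \<times> I) (\<lambda>(t, x1, x2). f t x1 x2)"
| "Ck (Suc n) I f \<longleftrightarrow> Ck n I f \<and>
     (\<forall>t x1. \<forall>x2\<in>I. (\<lambda>s. f s x1 x2) differentiable (at t) \<and>
        (\<lambda>s. f t s x2) differentiable (at x1) \<and>
        f t x1 differentiable (at x2 within I)) \<and>
     Ck n I (Dt f) \<and> Ck n I (D1 f) \<and> Ck n I (D2 I f)"


section \<open>Fourier multipliers on the circle\<close>

text \<open>Functions on the circle are \<open>2\<pi>\<close>-periodic functions on the real line.\<close>

definition fourier_coeff :: "(real \<Rightarrow> complex) \<Rightarrow> int \<Rightarrow> complex" where
  "fourier_coeff f n =
     integral {0..2 * pi} (\<lambda>x. f x * exp (- \<i> * of_int n * of_real x)) / of_real (2 * pi)"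

definition fourier_multiplier :: "(int \<Rightarrow> real) \<Rightarrow> (real \<Rightarrow> complex) \<Rightarrow> real \<Rightarrow> complex" where
  "fourier_multiplier m f x =
     (\<Sum>\<^sub>\<infinity>n\<in>UNIV. of_real (m n) * fourier_coeff f n * exp (\<i> * of_int n * of_real x))"

definition N_symbol :: "(side \<Rightarrow> real) \<Rightarrow> (side \<Rightarrow> real) \<Rightarrow> int \<Rightarrow> real" where
  "N_symbol \<rho> h n = \<bar>real_of_int n\<bar> *
     (tanh (\<bar>real_of_int n\<bar> * h Upper) / \<rho> Upper + tanh (\<bar>real_of_int n\<bar> * h Lower) / \<rho> Lower)"

text \<open>The symbol vanishes only at \<open>n = 0\<close>. Since \<open>inverse 0 = 0\<close>, the inverse below is the one onto
  mean-zero functions; its value on constants is immaterial, as it is only used under \<open>\<partial>\<^sub>1\<close>.\<close>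

definition N_inv :: "(side \<Rightarrow> real) \<Rightarrow> (side \<Rightarrow> real) \<Rightarrow> (real \<Rightarrow> complex) \<Rightarrow> real \<Rightarrow> complex" where
  "N_inv \<rho> h = fourier_multiplier (\<lambda>n. inverse (N_symbol \<rho> h n))"


section \<open>The linearized two phase Euler system\<close>

text \<open>Solutions are classical up to the boundary of each layer, so the traces on the walls and on
  the interface are pointwise values. \<open>Y1\<close>, \<open>Y2\<close> are the two components of \<open>Y\<close>.\<close>

definition linearized_euler ::
  "real \<Rightarrow> real \<Rightarrow> (side \<Rightarrow> real) \<Rightarrow> (side \<Rightarrow> real) \<Rightarrow> (side \<Rightarrow> real \<Rightarrow> real) \<Rightarrow>
   (real \<Rightarrow> real \<Rightarrow> complex) \<Rightarrow> (side \<Rightarrow> field3) \<Rightarrow> (side \<Rightarrow> field3) \<Rightarrow>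
   (side \<Rightarrow> field3) \<Rightarrow> (side \<Rightarrow> field3) \<Rightarrow> bool" where
  "linearized_euler g \<sigma> \<rho> h U z Y1 Y2 \<Gamma> P \<longleftrightarrow>
    Ck 2 UNIV (\<lambda>t x1 x2. z t x1) \<and>
    (\<forall>s. Ck 1 (closed_layer h s) (Y1 s) \<and> Ck 1 (closed_layer h s) (Y2 s) \<and>
         Ck 2 (closed_layer h s) (\<Gamma> s) \<and> Ck 2 (closed_layer h s) (P s)) \<and>
    (\<forall>t x1. z t (x1 + 2 * pi) = z t x1) \<and>
    (\<forall>s t x1. \<forall>x2\<in>closed_layer h s. \<forall>f\<in>{Y1 s, Y2 s, \<Gamma> s, P s}.
         f t (x1 + 2 * pi) x2 = f t x1 x2) \<and>
    (\<forall>s t x1. \<forall>x2\<in>open_layer h s.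
       let I = closed_layer h s;
           u = complex_of_real (U s x2);
           u' = complex_of_real (der I (U s) x2)
       in
         D1 (Y1 s) t x1 x2 + D2 I (Y2 s) t x1 x2 = 0 \<and>
         Dt (Y1 s) t x1 x2 + u * D1 (Y1 s) t x1 x2 + u' * Y2 s t x1 x2
           + u * D1 (D1 (\<Gamma> s)) t x1 x2 + D2 I (\<Gamma> s) t x1 x2 * u' + D1 (P s) t x1 x2 = 0 \<and>
         Dt (Y2 s) t x1 x2 + u * D1 (Y2 s) t x1 x2
           + u * D2 I (D1 (\<Gamma> s)) t x1 x2 + D2 I (P s) t x1 x2 = 0 \<and>
         D1 (D1 (\<Gamma> s)) t x1 x2 + D2 I (D2 I (\<Gamma> s)) t x1 x2 = 0 \<and>
         - (D1 (D1 (P s)) t x1 x2 + D2 I (D2 I (P s)) t x1 x2)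
           = 2 * u' * (D1 (Y2 s) t x1 x2 + D2 I (D1 (\<Gamma> s)) t x1 x2)) \<and>
    (\<forall>s t x1. Y2 s t x1 (wall h s) = 0 \<and>
       D2 (closed_layer h s) (\<Gamma> s) t x1 (wall h s) = 0 \<and>
       D2 (closed_layer h s) (P s) t x1 (wall h s) = 0) \<and>
    (\<forall>t x1. Y2 Upper t x1 0 = Y2 Lower t x1 0) \<and>
    (\<forall>s t x1.
       vector_derivative (\<lambda>\<tau>. z \<tau> x1) (at t) + of_real (U s 0) * vector_derivative (z t) (at x1)
         = Y2 s t x1 0 + D2 (closed_layer h s) (\<Gamma> s) t x1 0) \<and>
    (\<forall>s t x1. \<Gamma> s t x1 0 =
       of_real ((U Lower 0 - U Upper 0) / \<rho> s) * vector_derivative (N_inv \<rho> h (z t)) (at x1)) \<and>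
    (\<forall>t x1. of_real (\<rho> Upper) * P Upper t x1 0 - of_real (\<rho> Lower) * P Lower t x1 0 =
       of_real (g * (\<rho> Upper - \<rho> Lower)) * z t x1
         + of_real \<sigma> * vector_derivative (\<lambda>y. vector_derivative (z t) (at y)) (at x1))"

definition nontrivial_fields ::
  "(side \<Rightarrow> real) \<Rightarrow> (real \<Rightarrow> real \<Rightarrow> complex) \<Rightarrow> (side \<Rightarrow> field3) \<Rightarrow> (side \<Rightarrow> field3) \<Rightarrow>
   (side \<Rightarrow> field3) \<Rightarrow> (side \<Rightarrow> field3) \<Rightarrow> bool" where
  "nontrivial_fields h z Y1 Y2 \<Gamma> P \<longleftrightarrow>
     (\<exists>t x1. z t x1 \<noteq> 0) \<or>
     (\<exists>s t x1. \<exists>x2\<in>closed_layer h s.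
        Y1 s t x1 x2 \<noteq> 0 \<or> Y2 s t x1 x2 \<noteq> 0 \<or> \<Gamma> s t x1 x2 \<noteq> 0 \<or> P s t x1 x2 \<noteq> 0)"

definition mode_factor :: "int \<Rightarrow> complex \<Rightarrow> real \<Rightarrow> real \<Rightarrow> complex" where
  "mode_factor k c t x1 = exp (\<i> * of_int k * (of_real x1 - c * of_real t))"

definition mode_field :: "int \<Rightarrow> complex \<Rightarrow> (side \<Rightarrow> real \<Rightarrow> complex) \<Rightarrow> side \<Rightarrow> field3" where
  "mode_field k c a s t x1 x2 = a s x2 * mode_factor k c t x1"

definition is_eigenvalue ::
  "real \<Rightarrow> real \<Rightarrow> (side \<Rightarrow> real) \<Rightarrow> (side \<Rightarrow> real) \<Rightarrow> (side \<Rightarrow> real \<Rightarrow> real) \<Rightarrow>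
   int \<Rightarrow> complex \<Rightarrow> bool" where
  "is_eigenvalue g \<sigma> \<rho> h U k \<mu> \<longleftrightarrow>
     (\<exists>c \<zeta> y1 y2 \<gamma> p. \<mu> = - \<i> * of_int k * c \<and>
        (let z = (\<lambda>t x1. \<zeta> * mode_factor k c t x1);
             Y1 = mode_field k c y1; Y2 = mode_field k c y2;
             \<Gamma> = mode_field k c \<gamma>; P = mode_field k c p
         in linearized_euler g \<sigma> \<rho> h U z Y1 Y2 \<Gamma> P \<and> nontrivial_fields h z Y1 Y2 \<Gamma> P))"


section \<open>The reduced system\<close>

definition tanh_denominator :: "(side \<Rightarrow> real) \<Rightarrow> (side \<Rightarrow> real) \<Rightarrow> int \<Rightarrow> real" where
  "tanh_denominator \<rho> h k =
     \<rho> Lower * tanh (\<bar>real_of_int k\<bar> * h Upper) + \<rho> Upper * tanh (\<bar>real_of_int k\<bar> * h Lower)"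

text \<open>The coefficient \<open>U''/(U - c)\<close> has no meaning at a point where \<open>U = c\<close> (possible only for real
  \<open>c\<close>). At such a point the equation is understood after multiplication by \<open>U - c\<close>; everywhere
  else it is the Rayleigh equation as it stands.\<close>

definition rayleigh_at ::
  "real set \<Rightarrow> (real \<Rightarrow> real) \<Rightarrow> int \<Rightarrow> complex \<Rightarrow> (real \<Rightarrow> complex) \<Rightarrow> (real \<Rightarrow> complex) \<Rightarrow>
   real \<Rightarrow> bool" where
  "rayleigh_at I V k c y \<gamma> x \<longleftrightarrow>
    (let v = complex_of_real (V x); v'' = complex_of_real (der I (der I V) x)
     in if v \<noteq> c
        then - der I (der I y) x + (v'' / (v - c) + of_int k ^ 2) * y x
               + v'' / (v - c) * der I \<gamma> x = 0
        else v'' * (y x + der I \<gamma> x) = 0)"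

definition reduced_system ::
  "real \<Rightarrow> real \<Rightarrow> (side \<Rightarrow> real) \<Rightarrow> (side \<Rightarrow> real) \<Rightarrow> (side \<Rightarrow> real \<Rightarrow> real) \<Rightarrow> int \<Rightarrow>
   complex \<Rightarrow> complex \<Rightarrow> (side \<Rightarrow> real \<Rightarrow> complex) \<Rightarrow> (side \<Rightarrow> real \<Rightarrow> complex) \<Rightarrow> bool" where
  "reduced_system g \<sigma> \<rho> h U k c \<zeta> y2 \<gamma> \<longleftrightarrow>
    (let a = \<bar>real_of_int k\<bar>; d = tanh_denominator \<rho> h k; I = closed_layer h in
      (\<forall>s. C2_on (I s) (y2 s)) \<and>
      (\<forall>s. y2 s (wall h s) = 0) \<and>
      y2 Upper 0 = y2 Lower 0 \<and>
      (\<forall>s. \<forall>x\<in>I s. \<gamma> s x =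
         of_real (\<rho> (opposite s) * (U Lower 0 - U Upper 0) / (a * d)
           * (cosh (a * (x - wall h s)) / cosh (a * h s))) * (\<i> * of_int k * \<zeta>)) \<and>
      \<i> * of_int k *
        (of_real ((\<rho> Upper * U Upper 0 * tanh (a * h Lower)
                    + \<rho> Lower * U Lower 0 * tanh (a * h Upper)) / d) - c) * \<zeta> = y2 Upper 0 \<and>
      (\<forall>s. \<forall>x\<in>open_layer h s. rayleigh_at (I s) (U s) k c (y2 s) (\<gamma> s) x) \<and>
      of_real (g * jump \<rho> - \<sigma> * real_of_int k ^ 2) * \<zeta> =
        \<i> / of_int k *
         (- jump (\<lambda>s. of_real (\<rho> s) * (of_real (U s 0) - c) * der (I s) (y2 s) 0)
          + of_real (jump (\<lambda>s. \<rho> s * der (I s) (U s) 0)) * y2 Upper 0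
          - of_int k ^ 2 * of_real (jump (\<lambda>s. U s 0)) * of_real (\<rho> Upper) * \<gamma> Upper 0
          + jump (\<lambda>s. of_real (\<rho> s * der (I s) (U s) 0) * der (I s) (\<gamma> s) 0)))"

text \<open>The parameter \<open>c\<close> does not count for nontriviality.\<close>

definition nontrivial_reduced ::
  "(side \<Rightarrow> real) \<Rightarrow> complex \<Rightarrow> (side \<Rightarrow> real \<Rightarrow> complex) \<Rightarrow> (side \<Rightarrow> real \<Rightarrow> complex) \<Rightarrow> bool" where
  "nontrivial_reduced h \<zeta> y2 \<gamma> \<longleftrightarrow>
     \<zeta> \<noteq> 0 \<or> (\<exists>s. \<exists>x\<in>closed_layer h s. y2 s x \<noteq> 0 \<or> \<gamma> s x \<noteq> 0)"

end

theory Submission imports Defs begin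

text \<open>On a single Fourier mode, \<open>\<partial>\<^sub>1\<close> and \<open>\<partial>\<^sub>t\<close> act as multiplication by \<open>ik\<close> and \<open>-ikc\<close>, and the linearized
  system becomes a system of ordinary differential equations for the amplitudes. The harmonic amplitude
  \<open>\<gamma>\<close> is fixed by its value on the interface and the wall condition; its slopes at the interface turn
  both kinematic conditions into the same equation, with the weighted mean velocity as coefficient.
  Incompressibility gives \<open>\<Y>\<^sub>1\<close>, the horizontal momentum equation gives the pressure, and differentiating
  the latter shows that the vertical momentum equation is the Rayleigh equation multiplied by \<open>U - c\<close>. The
  Poisson equation and the wall condition for the pressure are then automatic. In the pressure jump,
  \<open>\<rho>\<gamma>\<close> is continuous across the interface, so that the terms in \<open>\<gamma>\<close> collapse to \<open>k\<^sup>2[U]\<rho>\<^sub>+\<gamma>\<^sub>+(0)\<close>.\<close>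

section \<open>One-sided derivatives on a layer\<close>

text \<open>A derivative within a set is unique only at limit points. That hypothesis turns a
  computed derivative into the value chosen by \<open>der\<close>.\<close>

lemma der_eq:
  assumes "(f has_vector_derivative f') (at x within I)" and "x islimpt I"
  shows "der I f x = f'"
  unfolding der_def using assms by (intro vector_derivative_within) (auto simp: trivial_limit_within)

lemma has_der:
  assumes "f differentiable_on I" and "x \<in> I"
  shows "(f has_vector_derivative der I f x) (at x within I)"
  using assms by (simp add: der_def differentiable_on_def vector_derivative_works)

text \<open>The derivative within \<open>I\<close> sees only values on \<open>I\<close>, and
  \<open>x\<close> itself lies in \<open>I\<close>. Values of an amplitude off its closed layer
  therefore never enter.\<close>

lemma der_cong:
  assumes eq: "\<And>y. y \<in> I \<Longrightarrow> f y = g y" and x: "x \<in> I"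
  shows "der I f x = der I g x"
proof -
  have "(f has_vector_derivative D) (at x within I) \<longleftrightarrow> (g has_vector_derivative D) (at x within I)" for D
    using eq x by (intro has_vector_derivative_cong_ev) (auto simp: eventually_at_filter)
  then show ?thesis by (simp add: der_def vector_derivative_def)
qed

lemma differentiable_on_cong:
  assumes "\<And>y. y \<in> I \<Longrightarrow> f y = g y" and "f differentiable_on I"
  shows "g differentiable_on I"
  using assms unfolding differentiable_on_def
  by (metis differentiable_transform_within zero_less_one)

lemma der_cmult:
  fixes f :: "real \<Rightarrow> complex"
  assumes "f differentiable_on I" "x \<in> I" "x islimpt I"
  shows "der I (\<lambda>x. C * f x) x = C * der I f x"
  using has_der[OF assms(1,2)] assms(3) by (intro der_eq has_vector_derivative_mult_right) auto

lemma der_mult_const: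
  fixes f :: "real \<Rightarrow> complex"
  assumes "f differentiable_on I" "x \<in> I" "x islimpt I"
  shows "der I (\<lambda>x. f x * C) x = der I f x * C"
  using der_cmult[OF assms, of C] by (simp add: mult.commute)

text \<open>The amplitude counterpart of \<open>Ck\<close>, with the same recursion so that the two
  can be compared level by level. A mode is smooth in \<open>t\<close> and \<open>x1\<close>, so
  only regularity in \<open>x2\<close> remains.\<close>

primrec Cn :: "nat \<Rightarrow> real set \<Rightarrow> (real \<Rightarrow> complex) \<Rightarrow> bool" where
  "Cn 0 I a \<longleftrightarrow> continuous_on I a"
| "Cn (Suc n) I a \<longleftrightarrow> Cn n I a \<and> a differentiable_on I \<and> Cn n I (der I a)"

lemma Cn_cong:
  assumes "\<And>x. x \<in> I \<Longrightarrow> f x = g x" and "Cn n I f"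
  shows "Cn n I g"
  using assms
proof (induction n arbitrary: f g)
  case 0
  then show ?case using continuous_on_cong[of I I f g] by simp
next
  case (Suc n)
  then have eq: "der I f x = der I g x" if "x \<in> I" for x
    using der_cong that by blast
  show ?case
    using Suc.IH[of f g] Suc.IH[OF eq] Suc.prems differentiable_on_cong[of I f g] by auto
qed

lemma Cn_1: "Cn 1 I a \<longleftrightarrow> a differentiable_on I \<and> continuous_on I (der I a)"
  by (auto simp: differentiable_imp_continuous_on)

lemma Cn_2: "Cn 2 I a \<longleftrightarrow> C2_on I a"
  by (auto simp: numeral_2_eq_2 C2_on_def differentiable_imp_continuous_on)

lemma Cn_cmult:
  assumes "\<And>x. x \<in> I \<Longrightarrow> x islimpt I" and "Cn n I f"
  shows "Cn n I (\<lambda>x. C * f x)"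
  using assms(2)
proof (induction n arbitrary: f)
  case 0
  then show ?case by (auto intro: continuous_intros)
next
  case (Suc n)
  have "C * der I f x = der I (\<lambda>x. C * f x) x" if "x \<in> I" for x
    using der_cmult[of f I x C] that assms(1) Suc.prems by simp
  then have "Cn n I (der I (\<lambda>x. C * f x))"
    using Suc Cn_cong[of I "\<lambda>x. C * der I f x" "der I (\<lambda>x. C * f x)" n] by auto
  moreover have "(\<lambda>x. C * f x) differentiable_on I"
    using Suc.prems by (auto simp: differentiable_on_def intro: differentiable_mult)
  ultimately show ?case
    using Suc by auto
qed

lemma Cn_const:
  assumes "\<And>x. x \<in> I \<Longrightarrow> x islimpt I"
  shows "Cn n I (\<lambda>x. C)"
proof (induction n arbitrary: C)
  case (Suc n)
  have "0 = der I (\<lambda>x. C) x" if "x \<in> I" for x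
    using assms[OF that] by (intro der_eq[symmetric]) auto
  then have "Cn n I (der I (\<lambda>x. C))"
    by (rule Cn_cong[OF _ Suc.IH[of 0]])
  then show ?case using Suc by auto
qed auto

section \<open>Geometry of the layers and extension of identities to the closure\<close>

lemma closed_layer_eq_closure:
  assumes "h s > 0"
  shows "closed_layer h s = closure (open_layer h s)"
  using assms by (cases s) auto

lemma open_subset_closed_layer: "x \<in> open_layer h s \<Longrightarrow> x \<in> closed_layer h s"
  by (cases s) auto

lemma zero_in_closed_layer: "h s > 0 \<Longrightarrow> 0 \<in> closed_layer h s"
  by (cases s) auto

lemma wall_in_closed_layer: "h s > 0 \<Longrightarrow> wall h s \<in> closed_layer h s"
  by (cases s) auto

lemma convex_closed_layer: "convex (closed_layer h s)"
  by (cases s) auto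

lemma islimpt_closed_layer:
  assumes "h s > 0" "x \<in> closed_layer h s"
  shows "x islimpt closed_layer h s"
  using assms by (cases s) auto

text \<open>The equations are imposed on the open layers, but their values at the walls and at the
  interface are needed. The difference of the two sides is continuous and vanishes on a dense
  subset.\<close>

lemma eq_on_closed_layer:
  fixes f g :: "real \<Rightarrow> complex"
  assumes "h s > 0" and f: "continuous_on (closed_layer h s) f" and g: "continuous_on (closed_layer h s) g"
    and eq: "\<And>x. x \<in> open_layer h s \<Longrightarrow> f x = g x" and x: "x \<in> closed_layer h s"
  shows "f x = g x"
proof -
  have "f x - g x = 0"
  proof (rule continuous_constant_on_closure[where S = "open_layer h s"])
    show "continuous_on (closure (open_layer h s)) (\<lambda>x. f x - g x)"
      using continuous_on_diff[OF f g] closed_layer_eq_closure[of h s, OF assms(1)] by simp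
    show "x \<in> closure (open_layer h s)"
      using x closed_layer_eq_closure[of h s, OF assms(1)] by simp
  qed (simp add: eq)
  then show ?thesis by simp
qed


section \<open>Single Fourier modes\<close>

lemma mode_factor_nonzero [simp]: "mode_factor k c t x \<noteq> 0"
  by (simp add: mode_factor_def)

lemma mode_factor_zero [simp]: "mode_factor k c 0 0 = 1"
  by (simp add: mode_factor_def)

lemma mode_factor_periodic: "mode_factor k c t (x + 2 * pi) = mode_factor k c t x"
proof -
  have "\<i> * of_int k * (of_real (x + 2 * pi) - c * of_real t)
      = \<i> * of_int k * (of_real x - c * of_real t) + \<i> * (of_int k * (of_real pi * 2))"
    by (simp add: algebra_simps)
  then show ?thesis
    by (simp only: mode_factor_def exp_plus_2pin)
qed

lemma mode_factor_deriv_x1: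
  "((\<lambda>x. mode_factor k c t x) has_vector_derivative \<i> * of_int k * mode_factor k c t x) (at x within A)"
  unfolding mode_factor_def
  by (rule has_vector_derivative_real_field) (auto intro!: derivative_eq_intros)

lemma mode_factor_deriv_t:
  "((\<lambda>t. mode_factor k c t x) has_vector_derivative - \<i> * of_int k * c * mode_factor k c t x) (at t within A)"
  unfolding mode_factor_def
  by (rule has_vector_derivative_real_field) (auto intro!: derivative_eq_intros)

lemma vector_derivative_mode:
  shows "vector_derivative (\<lambda>x. C * mode_factor k c t x) (at x) = \<i> * of_int k * C * mode_factor k c t x"
    and "vector_derivative (\<lambda>t. C * mode_factor k c t x) (at t) = - \<i> * of_int k * c * C * mode_factor k c t x"
  using has_vector_derivative_mult_right[OF mode_factor_deriv_x1[of k c t x UNIV], of C]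
    has_vector_derivative_mult_right[OF mode_factor_deriv_t[of k c x t UNIV], of C]
  by (auto intro!: vector_derivative_at simp: mult_ac)

text \<open>The result is again a mode field, with its amplitude multiplied by a constant, so the
  rule can be iterated and combined with derivatives in \<open>x2\<close>.\<close>

lemma D1_mode: "D1 (mode_field k c a s) = mode_field k c (\<lambda>s x. \<i> * of_int k * a s x) s"
  by (intro ext) (simp add: D1_def mode_field_def vector_derivative_mode)

lemma Dt_mode: "Dt (mode_field k c a s) = mode_field k c (\<lambda>s x. - \<i> * of_int k * c * a s x) s"
  by (intro ext) (simp add: Dt_def mode_field_def vector_derivative_mode)

lemma mode_differentiable:
  "(\<lambda>\<tau>. mode_field k c a s \<tau> x1 x2) differentiable (at t)"
  "(\<lambda>\<xi>. mode_field k c a s t \<xi> x2) differentiable (at x1)"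
  unfolding mode_field_def
  using differentiableI_vector[OF mode_factor_deriv_t] differentiableI_vector[OF mode_factor_deriv_x1]
  by (simp_all add: differentiable_mult)

lemma D2_mode:
  assumes "a s differentiable_on I" "x2 \<in> I" "x2 islimpt I"
  shows "D2 I (mode_field k c a s) t x1 x2 = der I (a s) x2 * mode_factor k c t x1"
  unfolding D2_def mode_field_def using der_mult_const[OF assms] .

lemma D2_D2_mode:
  assumes "a s differentiable_on I" "der I (a s) differentiable_on I" "x2 \<in> I"
    and "\<And>x. x \<in> I \<Longrightarrow> x islimpt I"
  shows "D2 I (D2 I (mode_field k c a s)) t x1 x2 = der I (der I (a s)) x2 * mode_factor k c t x1"
proof -
  \<comment> \<open>The formula for the inner derivative holds only on \<open>I\<close>, which
    suffices because the outer derivative is taken within \<open>I\<close>.\<close>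
  have "D2 I (D2 I (mode_field k c a s)) t x1 x2 = der I (\<lambda>x. der I (a s) x * mode_factor k c t x1) x2"
    unfolding D2_def[of I "D2 I _"] using assms by (intro der_cong D2_mode) auto
  then show ?thesis using der_mult_const[OF assms(2,3)] assms(3,4) by simp
qed

text \<open>Derivatives in \<open>t\<close> and \<open>x1\<close> are taken at fixed
  \<open>x2\<close>, and those in \<open>x2\<close> within \<open>I\<close>; no step of the
  recursion leaves \<open>I\<close>. This is needed because \<open>D2\<close> of a mode is known to
  be a mode only there.\<close>

lemma Ck_cong:
  assumes "\<And>t x1 x2. x2 \<in> I \<Longrightarrow> f t x1 x2 = g t x1 x2"
  shows "Ck n I f \<longleftrightarrow> Ck n I g"
  using assms
proof (induction n arbitrary: f g)
  case 0
  show ?case unfolding Ck.simps by (rule continuous_on_cong) (auto intro: 0)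
next
  case (Suc n)
  have diff: "(\<lambda>s. f s x1 x2) = (\<lambda>s. g s x1 x2)" "(\<lambda>s. f t s x2) = (\<lambda>s. g t s x2)"
    if "x2 \<in> I" for t x1 x2
    by (simp_all only: Suc.prems[OF that])
  have Dt: "Dt f t x1 x2 = Dt g t x1 x2" and D1: "D1 f t x1 x2 = D1 g t x1 x2" if "x2 \<in> I" for t x1 x2
    by (simp_all only: Dt_def D1_def diff[OF that])
  have D2: "D2 I f t x1 x2 = D2 I g t x1 x2" if "x2 \<in> I" for t x1 x2
    unfolding D2_def by (rule der_cong) (rule Suc.prems that, assumption?)+
  have diff2: "f t x1 differentiable (at x2 within I) \<longleftrightarrow> g t x1 differentiable (at x2 within I)"
    if "x2 \<in> I" for t x1 x2
    using that Suc.prems by (metis differentiable_transform_within zero_less_one)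
  have IH: "Ck n I f = Ck n I g" "Ck n I (Dt f) = Ck n I (Dt g)" "Ck n I (D1 f) = Ck n I (D1 g)"
    "Ck n I (D2 I f) = Ck n I (D2 I g)"
    by (rule Suc.IH, rule Suc.prems Dt D1 D2, assumption)+
  show ?case unfolding Ck.simps IH
    by (intro conj_cong all_cong1 ball_cong refl) (simp_all only: diff diff2)
qed

text \<open>The mode factor is smooth and has no zeros. \<open>Dt\<close> and \<open>D1\<close>
  multiply the amplitude by constants and \<open>D2\<close> differentiates it, so the induction runs
  over all amplitudes at once.\<close>

lemma Ck_mode_iff:
  assumes lim: "\<And>x. x \<in> I \<Longrightarrow> x islimpt I"
  shows "Ck n I (mode_field k c a s) \<longleftrightarrow> Cn n I (a s)"
proof (induction n arbitrary: a)
  case 0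
  have "continuous_on (UNIV \<times> UNIV \<times> I) (\<lambda>(t, x1, x2). mode_field k c a s t x1 x2) \<longleftrightarrow> continuous_on I (a s)"
  proof
    assume *: "continuous_on (UNIV \<times> UNIV \<times> I) (\<lambda>(t, x1, x2). mode_field k c a s t x1 x2)"
    \<comment> \<open>Restriction to \<open>t = x1 = 0\<close>, where the mode factor is 1, recovers
      the amplitude.\<close>
    have "continuous_on I (\<lambda>x. (\<lambda>(t, x1, x2). mode_field k c a s t x1 x2) (0, 0, x))"
      by (rule continuous_on_compose2[OF *]) (auto intro!: continuous_intros)
    then show "continuous_on I (a s)"
      by (simp add: mode_field_def)
  next
    assume *: "continuous_on I (a s)"
    have "continuous_on (UNIV \<times> UNIV \<times> I) (\<lambda>p. a s (snd (snd p)))"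
      by (rule continuous_on_compose2[OF *]) (auto intro!: continuous_intros)
    then show "continuous_on (UNIV \<times> UNIV \<times> I) (\<lambda>(t, x1, x2). mode_field k c a s t x1 x2)"
      unfolding mode_field_def mode_factor_def case_prod_beta by (intro continuous_intros)
  qed
  then show ?case by simp
next
  case (Suc n)
  have diff: "mode_field k c a s t x1 differentiable (at x within I) \<longleftrightarrow> a s differentiable (at x within I)"
    for t x1 x
  proof
    assume *: "mode_field k c a s t x1 differentiable (at x within I)"
    have "(\<lambda>x. mode_field k c a s t x1 x * inverse (mode_factor k c t x1)) differentiable (at x within I)"
      using * by (intro differentiable_mult) auto
    then show "a s differentiable (at x within I)"
      by (simp add: mode_field_def mult.assoc)
  next
    assume "a s differentiable (at x within I)"
    then have "(\<lambda>x. a s x * mode_factor k c t x1) differentiable (at x within I)"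
      by (intro differentiable_mult) auto
    then show "mode_field k c a s t x1 differentiable (at x within I)"
      by (simp add: mode_field_def[abs_def])
  qed
  have D2: "Ck n I (D2 I (mode_field k c a s)) \<longleftrightarrow> Cn n I (der I (a s))" if "a s differentiable_on I"
  proof -
    have "Ck n I (D2 I (mode_field k c a s)) \<longleftrightarrow> Ck n I (mode_field k c (\<lambda>s. der I (a s)) s)"
      using that lim by (intro Ck_cong) (simp add: D2_mode, simp add: mode_field_def)
    then show ?thesis by (simp add: Suc.IH)
  qed
  have "Cn n I (\<lambda>x. C * a s x)" if "Cn n I (a s)" for C
    using Cn_cmult[OF lim that] .
  note mult = this[of "\<i> * of_int k"] this[of "- \<i> * of_int k * c"]
  show ?case
    using D2 mult
    by (auto simp: Suc.IH D1_mode Dt_mode diff mode_differentiable differentiable_on_def)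
qed

section \<open>Fourier coefficients and the inverse multiplier on a single mode\<close>

lemma fourier_coeff_exp:
  "fourier_coeff (\<lambda>x. C * exp (\<i> * of_int k * of_real x)) n = (if n = k then C else 0)"
proof (cases "n = k")
  case True
  have "(\<lambda>x. C * exp (\<i> * of_int k * of_real x) * exp (- \<i> * of_int n * of_real x)) = (\<lambda>x. C)"
    using True by (simp add: fun_eq_iff mult.assoc flip: exp_add)
  then show ?thesis using True
    by (simp add: fourier_coeff_def scaleR_conv_of_real)
next
  case False
  \<comment> \<open>The frequency difference is nonzero, so the product of exponentials has the
    antiderivative \<open>C * exp (w * x) / w\<close>. This is 2 pi-periodic, and the integral over
    a period vanishes.\<close>
  define w where "w = \<i> * of_int (k - n)"
  have w: "w \<noteq> 0" using False by (simp add: w_def)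
  have eq: "C * exp (\<i> * of_int k * of_real x) * exp (- \<i> * of_int n * of_real x) = C * exp (w * of_real x)"
    for x :: real
    by (simp add: w_def mult.assoc algebra_simps flip: exp_add)
  have "((\<lambda>x. C * exp (w * of_real x)) has_integral
      (C * exp (w * of_real (2 * pi)) / w - C * exp (w * of_real 0) / w)) {0..2 * pi}"
  proof (rule fundamental_theorem_of_calculus)
    fix x :: real
    show "((\<lambda>x. C * exp (w * of_real x) / w) has_vector_derivative C * exp (w * of_real x)) (at x within {0..2 * pi})"
      using w by (intro has_vector_derivative_real_field[where f = "\<lambda>z. C * exp (w * z) / w"])
        (auto intro!: derivative_eq_intros)
  qed simp
  moreover have "exp (w * of_real (2 * pi)) = 1"
    using exp_integer_2pi[of "of_int (k - n)"] by (simp add: w_def mult_ac)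
  ultimately have "integral {0..2 * pi} (\<lambda>x. C * exp (w * of_real x)) = 0"
    by (intro integral_unique) auto
  then show ?thesis using False by (simp only: fourier_coeff_def eq) simp
qed

text \<open>At fixed \<open>t\<close> the mode is a constant multiple of one exponential. All
  Fourier coefficients but the \<open>k\<close>-th vanish, and the infinite sum collapses to one
  term.\<close>

lemma N_inv_mode:
  "N_inv \<rho> h (\<lambda>x. C * mode_factor k c t x) = (\<lambda>x. of_real (inverse (N_symbol \<rho> h k)) * C * mode_factor k c t x)"
proof
  fix x
  define E where "E = exp (- \<i> * of_int k * c * of_real t)"
  have m: "mode_factor k c t y = E * exp (\<i> * of_int k * of_real y)" for y
    by (simp add: mode_factor_def E_def algebra_simps flip: exp_add)
  have "fourier_coeff (\<lambda>x. C * mode_factor k c t x) n = (if n = k then C * E else 0)" for n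
    using fourier_coeff_exp[of "C * E" k n] by (simp add: m mult.assoc)
  then have "N_inv \<rho> h (\<lambda>x. C * mode_factor k c t x) x =
      (\<Sum>\<^sub>\<infinity>n\<in>{k}. of_real (inverse (N_symbol \<rho> h n)) * (if n = k then C * E else 0) * exp (\<i> * of_int n * of_real x))"
    unfolding N_inv_def fourier_multiplier_def by (intro infsum_cong_neutral) auto
  then show "N_inv \<rho> h (\<lambda>x. C * mode_factor k c t x) x = of_real (inverse (N_symbol \<rho> h k)) * C * mode_factor k c t x"
    by (simp add: m mult_ac)
qed


section \<open>The linearized system for the amplitudes\<close>

text \<open>The linearized system with the mode factor divided out. The Poisson equation and the
  wall condition for the pressure are kept, so that the comparison with the original system goes
  equation by equation.\<close>

definition mode_system ::
  "real \<Rightarrow> real \<Rightarrow> (side \<Rightarrow> real) \<Rightarrow> (side \<Rightarrow> real) \<Rightarrow> (side \<Rightarrow> real \<Rightarrow> real) \<Rightarrow> int \<Rightarrow>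
   complex \<Rightarrow> complex \<Rightarrow> (side \<Rightarrow> real \<Rightarrow> complex) \<Rightarrow> (side \<Rightarrow> real \<Rightarrow> complex) \<Rightarrow>
   (side \<Rightarrow> real \<Rightarrow> complex) \<Rightarrow> (side \<Rightarrow> real \<Rightarrow> complex) \<Rightarrow> bool" where
  "mode_system g \<sigma> \<rho> h U k c \<zeta> y1 y2 \<gamma> p \<longleftrightarrow>
    (\<forall>s. Cn 1 (closed_layer h s) (y1 s) \<and> Cn 1 (closed_layer h s) (y2 s) \<and>
         Cn 2 (closed_layer h s) (\<gamma> s) \<and> Cn 2 (closed_layer h s) (p s)) \<and>
    (\<forall>s. \<forall>x\<in>open_layer h s.
       let I = closed_layer h s; \<kappa> = \<i> * of_int k;
           u = of_real (U s x); u' = of_real (der I (U s) x)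
       in
         \<kappa> * y1 s x + der I (y2 s) x = 0 \<and>
         \<kappa> * ((u - c) * y1 s x + u * \<kappa> * \<gamma> s x) + u' * (y2 s x + der I (\<gamma> s) x) + \<kappa> * p s x = 0 \<and>
         \<kappa> * ((u - c) * y2 s x + u * der I (\<gamma> s) x) + der I (p s) x = 0 \<and>
         der I (der I (\<gamma> s)) x = of_int k ^ 2 * \<gamma> s x \<and>
         of_int k ^ 2 * p s x - der I (der I (p s)) x = 2 * u' * \<kappa> * (y2 s x + der I (\<gamma> s) x)) \<and>
    (\<forall>s. y2 s (wall h s) = 0 \<and> der (closed_layer h s) (\<gamma> s) (wall h s) = 0 \<and>
       der (closed_layer h s) (p s) (wall h s) = 0) \<and>
    y2 Upper 0 = y2 Lower 0 \<and>
    (\<forall>s. \<i> * of_int k * (of_real (U s 0) - c) * \<zeta> = y2 s 0 + der (closed_layer h s) (\<gamma> s) 0) \<and>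
    (\<forall>s. \<gamma> s 0 = of_real ((U Lower 0 - U Upper 0) / \<rho> s) *
       (\<i> * of_int k * of_real (inverse (N_symbol \<rho> h k)) * \<zeta>)) \<and>
    of_real (\<rho> Upper) * p Upper 0 - of_real (\<rho> Lower) * p Lower 0 =
      of_real (g * jump \<rho> - \<sigma> * real_of_int k ^ 2) * \<zeta>"

text \<open>Each equation is an amplitude equation times the mode factor, which never vanishes.
  Smoothness and periodicity of the interface mode, and periodicity of the fields, hold
  automatically.\<close>

lemma linearized_euler_mode_iff:
  assumes h: "\<And>s. h s > 0"
  shows "linearized_euler g \<sigma> \<rho> h U (\<lambda>t x1. \<zeta> * mode_factor k c t x1)
      (mode_field k c y1) (mode_field k c y2) (mode_field k c \<gamma>) (mode_field k c p)
    \<longleftrightarrow> mode_system g \<sigma> \<rho> h U k c \<zeta> y1 y2 \<gamma> p"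
proof -
  have lim: "x islimpt closed_layer h s" if "x \<in> closed_layer h s" for s x
    using islimpt_closed_layer[of h s] h that by blast
  have Ck: "Ck n (closed_layer h s) (mode_field k c a s) = Cn n (closed_layer h s) (a s)" for n a s
    using Ck_mode_iff lim by blast
  have "Ck 2 UNIV (mode_field k c (\<lambda>s x. \<zeta>) s)" for s
    unfolding Ck_mode_iff[of UNIV, OF islimpt_UNIV] by (rule Cn_const) (rule islimpt_UNIV)
  then have z: "Ck 2 UNIV (\<lambda>t x1 x2. \<zeta> * mode_factor k c t x1)"
    by (simp add: mode_field_def[abs_def])
  have per: "\<zeta> * mode_factor k c t (x + 2 * pi) = \<zeta> * mode_factor k c t x"
     "mode_field k c a s t (x + 2 * pi) x2 = mode_field k c a s t x x2" for a s t x x2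
    by (simp_all add: mode_field_def mode_factor_periodic)
  \<comment> \<open>Splits off the regularity conditions \<open>P\<close> and makes them available
    when the remaining equations are compared: the derivatives in \<open>x2\<close> can be computed
    only once the amplitudes are known to be differentiable.\<close>
  have drop: "A \<Longrightarrow> (P \<Longrightarrow> B = C) \<Longrightarrow> P = P' \<Longrightarrow> (A \<and> P \<and> B) = (P' \<and> C)" for A B C P P'
    by blast
  have bulk: "(\<forall>s t x1. \<forall>x2\<in>A s. Q s t x1 x2) = (\<forall>s. \<forall>x\<in>A s. Q' s x)"
    if "\<And>s t x1 x. x \<in> A s \<Longrightarrow> Q s t x1 x = Q' s x" for A :: "side \<Rightarrow> real set" and Q Q'
    using that by blast
  \<comment> \<open>Cancels the nonvanishing factor from an equation, with each equation expressed
    by the difference of its sides.\<close>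
  have scale: "(A = B) = (A' = B')" if "A - B = (A' - B') * mode_factor k c t x1"
    for A B A' B' :: complex and t x1
    using that by (metis mult_eq_0_iff mode_factor_nonzero right_minus_eq)
  have bdry: "(\<forall>s t x1. Q s t x1) = (\<forall>s. Q' s)" if "\<And>s t x1. Q s t x1 = Q' s"
    for Q and Q' :: "side \<Rightarrow> bool"
    using that by blast
  have bdry': "(\<forall>t x1. Q t x1) = Q'" if "\<And>t x1. Q t x1 = Q'"
    for Q :: "real \<Rightarrow> real \<Rightarrow> bool" and Q'
    using that by blast
  show ?thesis
    unfolding linearized_euler_def mode_system_def
  proof (rule drop[OF z], goal_cases)
    case 1
    have reg: "\<forall>s. Cn 1 (closed_layer h s) (y1 s) \<and> Cn 1 (closed_layer h s) (y2 s) \<and>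
         Cn 2 (closed_layer h s) (\<gamma> s) \<and> Cn 2 (closed_layer h s) (p s)"
      using 1 by (simp only: Ck simp_thms)
    have d: "y1 s differentiable_on closed_layer h s" "y2 s differentiable_on closed_layer h s"
      "\<gamma> s differentiable_on closed_layer h s" "p s differentiable_on closed_layer h s"
      "der (closed_layer h s) (\<gamma> s) differentiable_on closed_layer h s"
      "der (closed_layer h s) (p s) differentiable_on closed_layer h s" for s
      using reg[rule_format, of s] by (simp_all add: Cn_1 Cn_2 C2_on_def)
    have D2: "D2 (closed_layer h s) (mode_field k c y2 s) t x1 x2 = der (closed_layer h s) (y2 s) x2 * mode_factor k c t x1"
      "D2 (closed_layer h s) (mode_field k c \<gamma> s) t x1 x2 = der (closed_layer h s) (\<gamma> s) x2 * mode_factor k c t x1"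
      "D2 (closed_layer h s) (mode_field k c p s) t x1 x2 = der (closed_layer h s) (p s) x2 * mode_factor k c t x1"
      "D2 (closed_layer h s) (D2 (closed_layer h s) (mode_field k c \<gamma> s)) t x1 x2
        = der (closed_layer h s) (der (closed_layer h s) (\<gamma> s)) x2 * mode_factor k c t x1"
      "D2 (closed_layer h s) (D2 (closed_layer h s) (mode_field k c p s)) t x1 x2
        = der (closed_layer h s) (der (closed_layer h s) (p s)) x2 * mode_factor k c t x1"
      "D2 (closed_layer h s) (D1 (mode_field k c \<gamma> s)) t x1 x2
        = \<i> * of_int k * der (closed_layer h s) (\<gamma> s) x2 * mode_factor k c t x1"
      if "x2 \<in> closed_layer h s" for s t x1 x2
      using that d[of s] lim[of _ s]
        D2_mode[of "\<lambda>s x. \<i> * of_int k * \<gamma> s x" s "closed_layer h s" x2 k c t x1]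
        der_cmult[of "\<gamma> s" "closed_layer h s" x2 "\<i> * of_int k"]
      by (simp_all add: D1_mode D2_mode D2_D2_mode differentiable_on_def differentiable_mult)
    note D2_open = D2[OF open_subset_closed_layer] and D2_wall = D2[OF wall_in_closed_layer[of h, OF h]]
      and D2_zero = D2[OF zero_in_closed_layer[of h, OF h]]
    note modes = D1_mode Dt_mode mode_field_def[of k c]
    have drop2: "A \<Longrightarrow> A' \<Longrightarrow> B = C \<Longrightarrow> (A \<and> A' \<and> B) = C" for A A' B C
      by blast
    show ?case
    proof (rule drop2, goal_cases)
      case 1 show ?case by (simp add: per)
    next
      case 2 show ?case by (simp add: per)
    next
      case 3 show ?case
      proof (intro conj_cong, goal_cases)
        case 1
        show ?case
        proof (rule bulk, unfold Let_def, intro conj_cong, goal_cases)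
          case (1 s t x1 x)
          then show ?case
            by - (rule scale[of _ _ _ _ t x1], simp add: D2_open, simp add: modes algebra_simps)
        next
          case (2 s t x1 x)
          then show ?case
            by - (rule scale[of _ _ _ _ t x1], simp add: D2_open, simp add: modes algebra_simps)
        next
          case (3 s t x1 x)
          then show ?case
            by - (rule scale[of _ _ _ _ t x1], simp add: D2_open, simp add: modes algebra_simps)
        next
          case (4 s t x1 x)
          then show ?case
            by - (rule scale[of _ _ _ _ t x1], simp add: D2_open, simp add: modes algebra_simps power2_eq_square)
        next
          case (5 s t x1 x)
          then show ?case
            by - (rule scale[of _ _ _ _ t x1], simp add: D2_open, simp add: modes algebra_simps power2_eq_square)
        qed
      next
        case 2
        show ?case
          by (intro bdry) (simp add: D2_wall, simp add: modes)
      next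
        case 3
        show ?case
          by (intro bdry') (simp add: modes)
      next
        case 4
        show ?case
        proof (rule bdry)
          fix s t x1
          show "(vector_derivative (\<lambda>\<tau>. \<zeta> * mode_factor k c \<tau> x1) (at t)
              + of_real (U s 0) * vector_derivative (\<lambda>x1. \<zeta> * mode_factor k c t x1) (at x1)
              = mode_field k c y2 s t x1 0 + D2 (closed_layer h s) (mode_field k c \<gamma> s) t x1 0)
            \<longleftrightarrow> (\<i> * of_int k * (of_real (U s 0) - c) * \<zeta> = y2 s 0 + der (closed_layer h s) (\<gamma> s) 0)"
            by (rule scale[of _ _ _ _ t x1])
              (simp add: D2_zero vector_derivative_mode, simp add: modes algebra_simps)
        qed
      next
        case 5
        show ?case
        proof (rule bdry, goal_cases)
          case (1 s t x1)
          show ?case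
            unfolding N_inv_mode vector_derivative_mode
            by (rule scale[of _ _ _ _ t x1]) (simp add: modes algebra_simps)
        qed
      next
        case 6
        have zxx: "vector_derivative (\<lambda>y. vector_derivative (\<lambda>x. \<zeta> * mode_factor k c t x) (at y)) (at x1)
          = - (of_int k ^ 2 * \<zeta> * mode_factor k c t x1)" for t x1
          unfolding vector_derivative_mode by (simp add: power2_eq_square algebra_simps)
        show ?case
        proof (rule bdry', goal_cases)
          case (1 t x1)
          show ?case
            unfolding zxx by (rule scale[of _ _ _ _ t x1]) (simp add: modes algebra_simps jump_def)
        qed
      qed
    qed
  next
    case 2
    show ?case by (simp only: Ck)
  qed
qed


section \<open>The harmonic profile\<close>

lemma cosh_deriv:
  "((\<lambda>x. complex_of_real (cosh (a * (x - w)))) has_vector_derivative of_real (a * sinh (a * (x - w)))) (at x within I)"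
  "((\<lambda>x. complex_of_real (sinh (a * (x - w)))) has_vector_derivative of_real (a * cosh (a * (x - w)))) (at x within I)"
proof -
  have d: "((\<lambda>x. cosh (a * (x - w))) has_real_derivative a * sinh (a * (x - w))) (at x within I)"
    "((\<lambda>x. sinh (a * (x - w))) has_real_derivative a * cosh (a * (x - w))) (at x within I)"
    by (auto intro!: derivative_eq_intros)
  show "((\<lambda>x. complex_of_real (cosh (a * (x - w)))) has_vector_derivative of_real (a * sinh (a * (x - w)))) (at x within I)"
    "((\<lambda>x. complex_of_real (sinh (a * (x - w)))) has_vector_derivative of_real (a * cosh (a * (x - w)))) (at x within I)"
    using d[THEN has_vector_derivative_of_real]
    by blast+
qed

text \<open>With \<open>C\<close> and \<open>S\<close> the hyperbolic functions centred at
  \<open>w\<close>, both \<open>f' C - a f S\<close> and \<open>a f C - f' S\<close> are first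
  integrals of the equation. Their values at \<open>w\<close> are 0 and \<open>a f(w)\<close>, and
  \<open>C^2 - S^2 = 1\<close> allows one to solve for \<open>f\<close>.\<close>

lemma cosh_profile_unique:
  fixes f :: "real \<Rightarrow> complex"
  assumes C2: "C2_on I f" and I: "convex I" "w \<in> I" and a: "a \<noteq> 0"
    and ode: "\<And>x. x \<in> I \<Longrightarrow> der I (der I f) x = of_real a ^ 2 * f x"
    and w: "der I f w = 0" and x: "x \<in> I"
  shows "f x = f w * of_real (cosh (a * (x - w)))"
proof -
  define C S where "C = (\<lambda>x. complex_of_real (cosh (a * (x - w))))"
    and "S = (\<lambda>x. complex_of_real (sinh (a * (x - w))))"
  have CS: "C x ^ 2 - S x ^ 2 = 1"
    unfolding C_def S_def using hyperbolic_pythagoras[of "a * (x - w)"]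
    by (simp flip: of_real_power of_real_diff)
  have d: "(f has_vector_derivative der I f y) (at y within I)"
    "(der I f has_vector_derivative of_real a ^ 2 * f y) (at y within I)"
    "(C has_vector_derivative of_real a * S y) (at y within I)"
    "(S has_vector_derivative of_real a * C y) (at y within I)" if "y \<in> I" for y
    using C2 that has_der[of f I y] has_der[of "der I f" I y] ode[of y] cosh_deriv[of a w y I]
    by (auto simp: C2_on_def C_def S_def)
  have "\<exists>A. \<forall>y\<in>I. der I f y * C y - of_real a * f y * S y = A"
    by (rule has_vector_derivative_zero_constant[OF I(1), where f = "\<lambda>y. der I f y * C y - of_real a * f y * S y"])
      (auto intro!: derivative_eq_intros d simp: algebra_simps power2_eq_square)
  then have "der I f x * C x - of_real a * f x * S x = der I f w * C w - of_real a * f w * S w"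
    using I(2) x by metis
  then have A: "der I f x * C x - of_real a * f x * S x = 0"
    by (simp add: w S_def)
  have "\<exists>B. \<forall>y\<in>I. of_real a * f y * C y - der I f y * S y = B"
    by (rule has_vector_derivative_zero_constant[OF I(1), where f = "\<lambda>y. of_real a * f y * C y - der I f y * S y"])
      (auto intro!: derivative_eq_intros d simp: algebra_simps power2_eq_square)
  then have "of_real a * f x * C x - der I f x * S x = of_real a * f w * C w - der I f w * S w"
    using I(2) x by metis
  then have B: "of_real a * f x * C x - der I f x * S x = of_real a * f w"
    by (simp add: C_def S_def)
  have "of_real a * f x = of_real a * f x * (C x ^ 2 - S x ^ 2)"
    by (simp add: CS)
  also have "\<dots> = (of_real a * f x * C x - der I f x * S x) * C x
      + (der I f x * C x - of_real a * f x * S x) * S x"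
    by (simp add: algebra_simps power2_eq_square)
  also have "\<dots> = of_real a * (f w * C x)"
    unfolding A B by simp
  finally show ?thesis
    using a by (simp add: C_def)
qed

text \<open>The converse of \<open>cosh_profile_unique\<close>, obtained by differentiating twice.
  Agreement with the profile on \<open>I\<close> is enough, since all derivatives are taken within
  \<open>I\<close>.\<close>

lemma cosh_profile:
  fixes f :: "real \<Rightarrow> complex"
  assumes f: "\<And>x. x \<in> I \<Longrightarrow> f x = G * of_real (cosh (a * (x - w)))"
    and lim: "\<And>x. x \<in> I \<Longrightarrow> x islimpt I"
  shows "C2_on I f"
    and "x \<in> I \<Longrightarrow> der I f x = G * of_real (a * sinh (a * (x - w)))"
    and "x \<in> I \<Longrightarrow> der I (der I f) x = of_real a ^ 2 * f x"
proof -
  have d: "(f has_vector_derivative G * of_real (a * sinh (a * (x - w)))) (at x within I)" if "x \<in> I" for x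
    using has_vector_derivative_mult_right[OF cosh_deriv(1), of G a w x I] f that
    by (auto intro: has_vector_derivative_transform)
  then show d': "der I f x = G * of_real (a * sinh (a * (x - w)))" if "x \<in> I" for x
    using that lim by (blast intro: der_eq)
  have dd: "(der I f has_vector_derivative of_real a ^ 2 * f x) (at x within I)" if "x \<in> I" for x
  proof (rule has_vector_derivative_transform[OF that d'])
    show "((\<lambda>x. G * of_real (a * sinh (a * (x - w)))) has_vector_derivative of_real a ^ 2 * f x) (at x within I)"
      using has_vector_derivative_mult_right[OF cosh_deriv(2), of "G * of_real a" a w x I] f[OF that]
      by (simp add: power2_eq_square mult_ac)
  qed
  then show dd': "der I (der I f) x = of_real a ^ 2 * f x" if "x \<in> I" for x
    using that lim by (blast intro: der_eq)
  have diff: "f differentiable_on I" "der I f differentiable_on I"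
    using d dd by (auto simp: differentiable_on_def intro: differentiableI_vector)
  have "continuous_on I (\<lambda>x. of_real a ^ 2 * f x)"
    using differentiable_imp_continuous_on[OF diff(1)] by (intro continuous_intros)
  then show "C2_on I f"
    using diff dd' by (simp add: C2_on_def cong: continuous_on_cong)
qed

text \<open>The harmonic amplitude prescribed in \<open>reduced_system\<close>, named so that its
  boundary values and slopes can be computed separately.\<close>

definition interface_profile ::
  "(side \<Rightarrow> real) \<Rightarrow> (side \<Rightarrow> real) \<Rightarrow> (side \<Rightarrow> real \<Rightarrow> real) \<Rightarrow> int \<Rightarrow> complex \<Rightarrow> side \<Rightarrow> real \<Rightarrow> complex" where
  "interface_profile \<rho> h U k \<zeta> s x =
     of_real (\<rho> (opposite s) * (U Lower 0 - U Upper 0) / (\<bar>real_of_int k\<bar> * tanh_denominator \<rho> h k)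
       * (cosh (\<bar>real_of_int k\<bar> * (x - wall h s)) / cosh (\<bar>real_of_int k\<bar> * h s))) * (\<i> * of_int k * \<zeta>)"

lemma cosh_wall: "cosh (a * (0 - wall h s)) = cosh (a * h s)"
  by (cases s) simp_all

lemma tanh_denominator_pos:
  assumes "\<And>s. \<rho> s > 0" "\<And>s. h s > 0" "k \<noteq> 0"
  shows "tanh_denominator \<rho> h k > 0"
  using assms by (simp add: tanh_denominator_def add_pos_pos)

text \<open>Over a common denominator the symbol is
  \<open>\<bar>k\<bar> d / (\<rho> Upper * \<rho> Lower)\<close>, with \<open>d\<close> the
  hyperbolic tangent denominator. Dividing its inverse by one density leaves the opposite one, which
  explains the crossed densities in the formula for \<open>\<gamma>\<close>.\<close>

lemma inverse_N_symbol:
  assumes "\<And>s. \<rho> s > 0" "\<And>s. h s > 0" "k \<noteq> 0"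
  shows "inverse (N_symbol \<rho> h k) / \<rho> s = \<rho> (opposite s) / (\<bar>real_of_int k\<bar> * tanh_denominator \<rho> h k)"
proof -
  have N: "N_symbol \<rho> h k = \<bar>real_of_int k\<bar> * tanh_denominator \<rho> h k / (\<rho> Upper * \<rho> Lower)"
    using assms(1)[of Upper] assms(1)[of Lower]
    by (simp add: N_symbol_def tanh_denominator_def field_simps)
  have "\<rho> Upper \<noteq> 0" "\<rho> Lower \<noteq> 0"
    using assms(1)[of Upper] assms(1)[of Lower] by auto
  then show ?thesis
    unfolding N by (cases s) simp_all
qed

lemma interface_profile_at_0:
  assumes "\<And>s. \<rho> s > 0" "\<And>s. h s > 0" "k \<noteq> 0"
  shows "interface_profile \<rho> h U k \<zeta> s 0 = of_real ((U Lower 0 - U Upper 0) / \<rho> s) *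
       (\<i> * of_int k * of_real (inverse (N_symbol \<rho> h k)) * \<zeta>)"
proof -
  have "\<rho> (opposite s) * (U Lower 0 - U Upper 0) / (\<bar>real_of_int k\<bar> * tanh_denominator \<rho> h k)
       * (cosh (\<bar>real_of_int k\<bar> * (0 - wall h s)) / cosh (\<bar>real_of_int k\<bar> * h s))
     = (U Lower 0 - U Upper 0) * (\<rho> (opposite s) / (\<bar>real_of_int k\<bar> * tanh_denominator \<rho> h k))"
    unfolding cosh_wall by simp
  also have "\<dots> = (U Lower 0 - U Upper 0) / \<rho> s * inverse (N_symbol \<rho> h k)"
    unfolding inverse_N_symbol[of \<rho> h k s, OF assms, symmetric] by simp
  finally show ?thesis
    unfolding interface_profile_def by (simp only: of_real_mult mult_ac)
qed

text \<open>At the interface the ratio of hyperbolic cosines is 1, and both sides carry the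
  symmetric product of the two densities.\<close>

lemma interface_profile_balance:
  assumes "\<And>s. \<rho> s > 0" "\<And>s. h s > 0" "k \<noteq> 0"
  shows "of_real (\<rho> Upper) * interface_profile \<rho> h U k \<zeta> Upper 0
    = of_real (\<rho> Lower) * interface_profile \<rho> h U k \<zeta> Lower 0"
  unfolding interface_profile_def cosh_wall by (simp add: mult_ac)

text \<open>The last identity merges the two kinematic conditions: subtracting the slope of the
  profile from the velocity term gives the same weighted mean velocity on either side.\<close>

lemma interface_profile_properties:
  assumes \<rho>: "\<And>s. \<rho> s > 0" and h: "\<And>s. h s > 0" and k: "k \<noteq> 0"
    and f: "\<forall>x\<in>closed_layer h s. f x = interface_profile \<rho> h U k \<zeta> s x"
  shows "C2_on (closed_layer h s) f"
    and "\<And>x. x \<in> closed_layer h s \<Longrightarrow> der (closed_layer h s) (der (closed_layer h s) f) x = of_int k ^ 2 * f x"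
    and "der (closed_layer h s) f (wall h s) = 0"
    and "\<i> * of_int k * of_real (U s 0) * \<zeta> - der (closed_layer h s) f 0 =
      \<i> * of_int k * of_real ((\<rho> Upper * U Upper 0 * tanh (\<bar>real_of_int k\<bar> * h Lower)
        + \<rho> Lower * U Lower 0 * tanh (\<bar>real_of_int k\<bar> * h Upper)) / tanh_denominator \<rho> h k) * \<zeta>"
proof -
  define a d where "a = \<bar>real_of_int k\<bar>" and "d = tanh_denominator \<rho> h k"
  define J where "J = U Lower 0 - U Upper 0"
  define G where "G = of_real (\<rho> (opposite s) * J / (a * d) / cosh (a * h s)) * (\<i> * of_int k * \<zeta>)"
  have a: "a > 0" and d: "d > 0"
    using k tanh_denominator_pos[OF \<rho> h k] by (auto simp: a_def d_def)
  have f': "f x = G * of_real (cosh (a * (x - wall h s)))" if "x \<in> closed_layer h s" for x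
    using f that by (simp add: interface_profile_def G_def a_def d_def J_def mult_ac)
  note lim = islimpt_closed_layer[of h s, OF h]
  note prof = cosh_profile[where I = "closed_layer h s", OF f' lim, simplified]
  show "C2_on (closed_layer h s) f"
    using prof(1) .
  show "der (closed_layer h s) (der (closed_layer h s) f) x = of_int k ^ 2 * f x" if "x \<in> closed_layer h s" for x
  proof -
    have "complex_of_real a ^ 2 = of_int k ^ 2"
      unfolding a_def of_real_power[symmetric] power2_abs by simp
    then show ?thesis using prof(3)[OF that] by simp
  qed
  show "der (closed_layer h s) f (wall h s) = 0"
    using prof(2)[OF wall_in_closed_layer[of h, OF h]] by simp
  have "der (closed_layer h s) f 0 = G * of_real (a * sinh (a * (0 - wall h s)))"
    using prof(2)[OF zero_in_closed_layer[of h, OF h]] by simp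
  also have "\<dots> = of_real (\<rho> (opposite s) * J / d * (sinh (a * (0 - wall h s)) / cosh (a * h s))) * (\<i> * of_int k * \<zeta>)"
    using a by (simp add: G_def)
  finally have slope: "der (closed_layer h s) f 0 =
    of_real (\<rho> (opposite s) * J / d * (sinh (a * (0 - wall h s)) / cosh (a * h s))) * (\<i> * of_int k * \<zeta>)" .
  \<comment> \<open>Multiplied by \<open>d\<close>, the term with \<open>U s 0\<close> and the
    tangent of the layer \<open>s\<close> itself cancels. The sign of the hyperbolic sine at the
    interface depends on the side, hence the case split.\<close>
  have speed: "U s 0 - \<rho> (opposite s) * J / d * (sinh (a * (0 - wall h s)) / cosh (a * h s)) =
    (\<rho> Upper * U Upper 0 * tanh (a * h Lower) + \<rho> Lower * U Lower 0 * tanh (a * h Upper)) / d"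
  proof -
    have "d = \<rho> Lower * tanh (a * h Upper) + \<rho> Upper * tanh (a * h Lower)"
      by (simp add: d_def a_def tanh_denominator_def)
    moreover have "sinh (a * (0 - wall h s)) / cosh (a * h s) =
      (case s of Upper \<Rightarrow> - tanh (a * h Upper) | Lower \<Rightarrow> tanh (a * h Lower))"
      by (cases s) (simp_all add: tanh_def)
    ultimately show ?thesis
      using d by (cases s) (simp_all add: J_def field_simps)
  qed
  show "\<i> * of_int k * of_real (U s 0) * \<zeta> - der (closed_layer h s) f 0 =
      \<i> * of_int k * of_real ((\<rho> Upper * U Upper 0 * tanh (\<bar>real_of_int k\<bar> * h Lower)
        + \<rho> Lower * U Lower 0 * tanh (\<bar>real_of_int k\<bar> * h Upper)) / tanh_denominator \<rho> h k) * \<zeta>"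
    unfolding slope a_def[symmetric] d_def[symmetric] speed[symmetric]
    by (simp only: of_real_diff algebra_simps)
qed


section \<open>Reduction\<close>

text \<open>Where \<open>U\<close> differs from \<open>c\<close> this is multiplication by
  \<open>U - c\<close>; where they agree the first term drops out and the convention of
  \<open>rayleigh_at\<close> remains. The product form is free of singularities and extends
  continuously to the boundary.\<close>

lemma rayleigh_at_iff:
  "rayleigh_at I V k c y \<gamma> x \<longleftrightarrow>
    (of_real (V x) - c) * (of_int k ^ 2 * y x - der I (der I y) x)
      + of_real (der I (der I V) x) * (y x + der I \<gamma> x) = 0"
proof (cases "of_real (V x) = c")
  case False
  then have v: "of_real (V x) - c \<noteq> 0" by simp
  have alg: "v * (K * b - e) + w * (b + d) = v * (- e + (w / v + K) * b + w / v * d)" if "v \<noteq> 0"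
    for v w K b d e :: complex
    using that by (simp add: field_simps)
  have "(of_real (V x) - c) * (of_int k ^ 2 * y x - der I (der I y) x)
      + of_real (der I (der I V) x) * (y x + der I \<gamma> x)
    = (of_real (V x) - c) * (- der I (der I y) x + (of_real (der I (der I V) x) / (of_real (V x) - c) + of_int k ^ 2) * y x
               + of_real (der I (der I V) x) / (of_real (V x) - c) * der I \<gamma> x)"
    using v by (rule alg)
  then show ?thesis
    using v False by (simp add: rayleigh_at_def Let_def)
qed (simp add: rayleigh_at_def Let_def)

text \<open>The pressure amplitude determined by the horizontal momentum equation, with \<open>\<Y>\<^sub>1\<close> eliminated by
  incompressibility.\<close>

definition mode_pressure ::
  "int \<Rightarrow> complex \<Rightarrow> real set \<Rightarrow> (real \<Rightarrow> real) \<Rightarrow> (real \<Rightarrow> complex) \<Rightarrow> (real \<Rightarrow> complex) \<Rightarrow> real \<Rightarrow> complex" where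
  "mode_pressure k c I V y \<gamma> x =
     \<i> / of_int k * (of_real (der I V x) * (y x + der I \<gamma> x) - (of_real (V x) - c) * der I y x)
       - \<i> * of_int k * of_real (V x) * \<gamma> x"

lemma has_der_of_real:
  assumes "V differentiable_on I" "x \<in> I"
  shows "((\<lambda>x. complex_of_real (V x)) has_vector_derivative of_real (der I V x)) (at x within I)"
  using has_der[OF assms]
  by (intro has_vector_derivative_of_real) (simp add: has_real_derivative_iff_has_vector_derivative)

text \<open>Once \<open>y1\<close> is eliminated by incompressibility, the residual of the
  horizontal momentum equation is \<open>ik\<close> times the difference of \<open>p\<close> and
  \<open>mode_pressure\<close>.\<close>

lemma mode_pressure_momentum:
  assumes k: "k \<noteq> 0" and "\<i> * of_int k * y1 + der I y x = 0"
  shows "\<i> * of_int k * ((of_real (V x) - c) * y1 + of_real (V x) * (\<i> * of_int k) * \<gamma> x)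
      + of_real (der I V x) * (y x + der I \<gamma> x) + \<i> * of_int k * p = 0
    \<longleftrightarrow> p = mode_pressure k c I V y \<gamma> x"
proof -
  have y': "der I y x = - (\<i> * of_int k * y1)"
    using assms(2) by (simp add: add_eq_0_iff)
  have "\<i> * of_int k * (p - mode_pressure k c I V y \<gamma> x) =
    \<i> * of_int k * ((of_real (V x) - c) * y1 + of_real (V x) * (\<i> * of_int k) * \<gamma> x)
      + of_real (der I V x) * (y x + der I \<gamma> x) + \<i> * of_int k * p"
    unfolding mode_pressure_def y' using k by (simp add: algebra_simps)
  then show ?thesis
    using k by (metis mult_eq_0_iff right_minus_eq complex_i_not_zero of_int_eq_0_iff)
qed

text \<open>The derivative is \<open>i/k\<close> times the Rayleigh residual minus the transport
  terms of the vertical momentum equation. Harmonicity enters through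
  \<open>\<gamma>'' = k^2 \<gamma>\<close>, which cancels the two terms in
  \<open>U' \<gamma>\<close>.\<close>

lemma mode_pressure_deriv:
  assumes k: "k \<noteq> 0" and V: "V differentiable_on I" "der I V differentiable_on I"
    and y: "C2_on I y" and \<gamma>: "C2_on I \<gamma>"
    and harm: "der I (der I \<gamma>) x = of_int k ^ 2 * \<gamma> x" and x: "x \<in> I"
  shows "(mode_pressure k c I V y \<gamma> has_vector_derivative
     \<i> / of_int k * ((of_real (V x) - c) * (of_int k ^ 2 * y x - der I (der I y) x)
       + of_real (der I (der I V) x) * (y x + der I \<gamma> x))
     - \<i> * of_int k * ((of_real (V x) - c) * y x + of_real (V x) * der I \<gamma> x)) (at x within I)"
proof -
  have d: "(y has_vector_derivative der I y x) (at x within I)"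
    "(der I y has_vector_derivative der I (der I y) x) (at x within I)"
    "(\<gamma> has_vector_derivative der I \<gamma> x) (at x within I)"
    "(der I \<gamma> has_vector_derivative of_int k ^ 2 * \<gamma> x) (at x within I)"
    "((\<lambda>x. complex_of_real (V x)) has_vector_derivative of_real (der I V x)) (at x within I)"
    "((\<lambda>x. complex_of_real (der I V x)) has_vector_derivative of_real (der I (der I V) x)) (at x within I)"
    using y \<gamma> V x harm has_der[of y I x] has_der[of "der I y" I x] has_der[of \<gamma> I x] has_der[of "der I \<gamma>" I x]
      has_der_of_real[of V I x] has_der_of_real[of "der I V" I x]
    by (auto simp: C2_on_def)
  show ?thesis
    unfolding mode_pressure_def[abs_def]
    by (rule has_vector_derivative_eq_rhs, (rule derivative_intros d)+)
      (use k in \<open>simp add: field_simps power2_eq_square\<close>)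
qed

text \<open>Only the terms in \<open>U \<gamma>\<close> need an argument: continuity of
  \<open>\<rho> \<gamma>\<close> lets the common value be taken out of the jump, leaving the jump of
  \<open>U\<close>.\<close>

lemma mode_pressure_jump:
  assumes k: "k \<noteq> 0" and y: "y2 Upper 0 = y2 Lower 0"
    and bal: "of_real (\<rho> Upper) * \<gamma> Upper 0 = of_real (\<rho> Lower) * \<gamma> Lower 0"
  shows "of_real (\<rho> Upper) * mode_pressure k c (I Upper) (U Upper) (y2 Upper) (\<gamma> Upper) 0
      - of_real (\<rho> Lower) * mode_pressure k c (I Lower) (U Lower) (y2 Lower) (\<gamma> Lower) 0 =
    \<i> / of_int k *
         (- jump (\<lambda>s. of_real (\<rho> s) * (of_real (U s 0) - c) * der (I s) (y2 s) 0)
          + of_real (jump (\<lambda>s. \<rho> s * der (I s) (U s) 0)) * y2 Upper 0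
          - of_int k ^ 2 * of_real (jump (\<lambda>s. U s 0)) * of_real (\<rho> Upper) * \<gamma> Upper 0
          + jump (\<lambda>s. of_real (\<rho> s * der (I s) (U s) 0) * der (I s) (\<gamma> s) 0))"
proof -
  have "of_int k ^ 2 * of_real (jump (\<lambda>s. U s 0)) * of_real (\<rho> Upper) * \<gamma> Upper 0
    = of_int k ^ 2 * (of_real (U Upper 0) * (of_real (\<rho> Upper) * \<gamma> Upper 0) - of_real (U Lower 0) * (of_real (\<rho> Lower) * \<gamma> Lower 0))"
    unfolding bal[symmetric] jump_def by (simp add: algebra_simps)
  note jU = this
  show ?thesis
    unfolding jU unfolding mode_pressure_def y jump_def using k
    by (simp add: field_simps power2_eq_square)
qed

lemma smooth_on_diff:
  assumes "smooth_on I V"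
  shows "V differentiable_on I" "der I V differentiable_on I" "continuous_on I (der I (der I V))"
  using assms[unfolded smooth_on_def, rule_format, of 0] assms[unfolded smooth_on_def, rule_format, of 1]
    assms[unfolded smooth_on_def, rule_format, of 2]
  by (auto simp: numeral_2_eq_2 differentiable_imp_continuous_on)

section \<open>Equivalence of the amplitude system and the reduced system\<close>

context
  fixes g \<sigma> :: real and \<rho> h :: "side \<Rightarrow> real" and U :: "side \<Rightarrow> real \<Rightarrow> real" and k :: int and c :: complex
  assumes \<rho>: "\<And>s. \<rho> s > 0" and h: "\<And>s. h s > 0"
    and U: "\<And>s. smooth_on (closed_layer h s) (U s)" and k: "k \<noteq> 0"
begin

private abbreviation (input) "L s \<equiv> closed_layer h s"

private lemma lim: "x \<in> L s \<Longrightarrow> x islimpt L s"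
  using islimpt_closed_layer[of h s, OF h] .

private lemma zeroL: "0 \<in> L s"
  using zero_in_closed_layer[of h s, OF h] .

private lemma wallL: "wall h s \<in> L s"
  using wall_in_closed_layer[of h s, OF h] .

private lemmas U_diff = smooth_on_diff[OF U]

private lemma cont_U: "continuous_on (L s) (U s)" "continuous_on (L s) (der (L s) (U s))"
  using U_diff by (auto intro: differentiable_imp_continuous_on)

text \<open>Besides the reduced system, this records that \<open>y1\<close> and \<open>p\<close> are
  determined by \<open>y2\<close> and \<open>\<gamma>\<close>, as needed to transfer
  nontriviality.\<close>

lemma mode_system_imp_reduced:
  assumes "mode_system g \<sigma> \<rho> h U k c \<zeta> y1 y2 \<gamma> p"
  shows "reduced_system g \<sigma> \<rho> h U k c \<zeta> y2 \<gamma>"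
    and "\<And>s x. x \<in> L s \<Longrightarrow> \<i> * of_int k * y1 s x + der (L s) (y2 s) x = 0"
    and "\<And>s x. x \<in> L s \<Longrightarrow> p s x = mode_pressure k c (L s) (U s) (y2 s) (\<gamma> s) x"
proof -
  define \<kappa> where "\<kappa> = \<i> * complex_of_int k"
  have \<kappa>: "\<kappa> \<noteq> 0" using k by (simp add: \<kappa>_def)
  note sys = assms[unfolded mode_system_def Let_def, folded \<kappa>_def]
  have reg: "Cn 1 (L s) (y1 s)" "Cn 1 (L s) (y2 s)" "C2_on (L s) (\<gamma> s)" "C2_on (L s) (p s)" for s
    using sys Cn_2 by blast+
  have diff: "y1 s differentiable_on L s" "y2 s differentiable_on L s" "\<gamma> s differentiable_on L s"
    "p s differentiable_on L s" "der (L s) (\<gamma> s) differentiable_on L s" for s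
    using reg[of s] by (auto simp: Cn_1 C2_on_def)
  have cont: "continuous_on (L s) (y1 s)" "continuous_on (L s) (y2 s)" "continuous_on (L s) (\<gamma> s)"
    "continuous_on (L s) (p s)" "continuous_on (L s) (der (L s) (y2 s))"
    "continuous_on (L s) (der (L s) (\<gamma> s))" "continuous_on (L s) (der (L s) (der (L s) (\<gamma> s)))" for s
    using diff[of s] reg[of s] by (auto simp: Cn_1 C2_on_def intro: differentiable_imp_continuous_on)
  have sys_open: "\<kappa> * y1 s x + der (L s) (y2 s) x = 0"
      "\<kappa> * ((of_real (U s x) - c) * y1 s x + of_real (U s x) * \<kappa> * \<gamma> s x)
        + of_real (der (L s) (U s) x) * (y2 s x + der (L s) (\<gamma> s) x) + \<kappa> * p s x = 0"
      "\<kappa> * ((of_real (U s x) - c) * y2 s x + of_real (U s x) * der (L s) (\<gamma> s) x) + der (L s) (p s) x = 0"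
      "der (L s) (der (L s) (\<gamma> s)) x = of_int k ^ 2 * \<gamma> s x"
    if "x \<in> open_layer h s" for s x
    using sys that by blast+
  have div: "\<kappa> * y1 s x + der (L s) (y2 s) x = 0" if "x \<in> L s" for s x
    by (rule eq_on_closed_layer[of h s, OF h _ _ sys_open(1) that]) (intro continuous_intros cont)+
  then show "\<And>s x. x \<in> L s \<Longrightarrow> \<i> * of_int k * y1 s x + der (L s) (y2 s) x = 0"
    by (simp add: \<kappa>_def)
  have mom1: "\<kappa> * ((of_real (U s x) - c) * y1 s x + of_real (U s x) * \<kappa> * \<gamma> s x)
        + of_real (der (L s) (U s) x) * (y2 s x + der (L s) (\<gamma> s) x) + \<kappa> * p s x = 0" if "x \<in> L s" for s x
    by (rule eq_on_closed_layer[of h s, OF h _ _ sys_open(2) that]) (intro continuous_intros cont cont_U)+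
  have harm: "der (L s) (der (L s) (\<gamma> s)) x = of_int k ^ 2 * \<gamma> s x" if "x \<in> L s" for s x
    by (rule eq_on_closed_layer[of h s, OF h _ _ sys_open(4) that]) (intro continuous_intros cont)+
  show p: "p s x = mode_pressure k c (L s) (U s) (y2 s) (\<gamma> s) x" if "x \<in> L s" for s x
    using mode_pressure_momentum[OF k, of "y1 s x" "L s" "y2 s" x "U s" c "\<gamma> s" "p s x"]
      div[OF that] mom1[OF that] by (simp add: \<kappa>_def)
  \<comment> \<open>The system gives only one continuous derivative of \<open>y2\<close>. The second
    comes from incompressibility, since \<open>y2'\<close> is a multiple of the continuously
    differentiable \<open>y1\<close>.\<close>
  have y2'': "C2_on (L s) (y2 s)" for s
  proof -
    have "- \<kappa> * y1 s x = der (L s) (y2 s) x" if "x \<in> L s" for x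
      using div[OF that] by (simp add: add_eq_0_iff)
    then have "Cn 1 (L s) (der (L s) (y2 s))"
      using Cn_cmult[OF lim reg(1)] by (rule Cn_cong)
    then show ?thesis
      using diff(2) by (simp add: C2_on_def Cn_1)
  qed
  \<comment> \<open>The wall condition fixes the profile up to its value at the wall, and the
    prescribed value on the interface then fixes that number.\<close>
  have \<gamma>: "\<forall>x\<in>L s. \<gamma> s x = interface_profile \<rho> h U k \<zeta> s x" for s
  proof
    fix x assume x: "x \<in> L s"
    let ?a = "\<bar>real_of_int k\<bar>" and ?w = "wall h s"
    have a2: "complex_of_real ?a ^ 2 = of_int k ^ 2"
      unfolding of_real_power[symmetric] power2_abs by simp
    have "der (L s) (\<gamma> s) ?w = 0"
      using sys by blast
    then have prof: "\<gamma> s y = \<gamma> s ?w * of_real (cosh (?a * (y - ?w)))" if "y \<in> L s" for y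
      using cosh_profile_unique[OF reg(3) convex_closed_layer wallL, of ?a s y] k harm that a2 by simp
    have "\<gamma> s 0 = interface_profile \<rho> h U k \<zeta> s 0"
      using sys interface_profile_at_0[of \<rho> h k U \<zeta> s, OF \<rho> h k] by (simp add: \<kappa>_def)
    then have "\<gamma> s ?w * of_real (cosh (?a * h s)) = interface_profile \<rho> h U k \<zeta> s 0"
      using prof[OF zeroL, unfolded cosh_wall] by simp
    then have "\<gamma> s ?w = interface_profile \<rho> h U k \<zeta> s 0 / of_real (cosh (?a * h s))"
      by (simp add: field_simps)
    moreover have "interface_profile \<rho> h U k \<zeta> s x
        = interface_profile \<rho> h U k \<zeta> s 0 / of_real (cosh (?a * h s)) * of_real (cosh (?a * (x - ?w)))"
      unfolding interface_profile_def cosh_wall by simp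
    ultimately show "\<gamma> s x = interface_profile \<rho> h U k \<zeta> s x"
      using prof[OF x] by simp
  qed
  note prof = interface_profile_properties[of \<rho> h k _ "\<gamma> _", OF \<rho> h k \<gamma>]
  have y0: "y2 Upper 0 = y2 Lower 0" and kin: "\<kappa> * (of_real (U Upper 0) - c) * \<zeta> = y2 Upper 0 + der (L Upper) (\<gamma> Upper) 0"
    and dyn: "of_real (\<rho> Upper) * p Upper 0 - of_real (\<rho> Lower) * p Lower 0 =
      of_real (g * jump \<rho> - \<sigma> * real_of_int k ^ 2) * \<zeta>"
    using sys by blast+
  have rayleigh: "rayleigh_at (L s) (U s) k c (y2 s) (\<gamma> s) x" if "x \<in> open_layer h s" for s x
  proof -
    have x: "x \<in> L s" using that by (rule open_subset_closed_layer)
    \<comment> \<open>Comparing this derivative with the vertical momentum equation leaves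
      \<open>i/k\<close> times the Rayleigh residual, which must vanish.\<close>
    have "(p s has_vector_derivative \<i> / of_int k * ((of_real (U s x) - c) * (of_int k ^ 2 * y2 s x - der (L s) (der (L s) (y2 s)) x)
         + of_real (der (L s) (der (L s) (U s)) x) * (y2 s x + der (L s) (\<gamma> s) x))
       - \<i> * of_int k * ((of_real (U s x) - c) * y2 s x + of_real (U s x) * der (L s) (\<gamma> s) x)) (at x within L s)"
      by (rule has_vector_derivative_transform[OF x p mode_pressure_deriv[OF k U_diff(1,2) y2'' reg(3) harm[OF x] x]])
    from der_eq[OF this lim[OF x]] sys_open(3)[OF that] k
    show ?thesis
      by (simp add: rayleigh_at_iff \<kappa>_def)
  qed
  have "of_real (\<rho> Upper) * \<gamma> Upper 0 = of_real (\<rho> Lower) * \<gamma> Lower 0"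
    using interface_profile_balance[of \<rho> h k U \<zeta>, OF \<rho> h k] bspec[OF \<gamma> zeroL] by simp
  note jump = mode_pressure_jump[of k y2 \<rho> \<gamma> c "closed_layer h" U, OF k y0 this]
  show "reduced_system g \<sigma> \<rho> h U k c \<zeta> y2 \<gamma>"
    unfolding reduced_system_def Let_def
  proof (intro conjI allI ballI)
    show "y2 s (wall h s) = 0" for s using sys by blast
    show "\<i> * of_int k * (of_real ((\<rho> Upper * U Upper 0 * tanh (\<bar>real_of_int k\<bar> * h Lower)
          + \<rho> Lower * U Lower 0 * tanh (\<bar>real_of_int k\<bar> * h Upper)) / tanh_denominator \<rho> h k) - c) * \<zeta> = y2 Upper 0"
      using prof(4)[of Upper] kin by (simp add: \<kappa>_def algebra_simps)
    show "of_real (g * jump \<rho> - \<sigma> * real_of_int k ^ 2) * \<zeta> =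
        \<i> / of_int k *
         (- jump (\<lambda>s. of_real (\<rho> s) * (of_real (U s 0) - c) * der (L s) (y2 s) 0)
          + of_real (jump (\<lambda>s. \<rho> s * der (L s) (U s) 0)) * y2 Upper 0
          - of_int k ^ 2 * of_real (jump (\<lambda>s. U s 0)) * of_real (\<rho> Upper) * \<gamma> Upper 0
          + jump (\<lambda>s. of_real (\<rho> s * der (L s) (U s) 0) * der (L s) (\<gamma> s) 0))"
      using jump dyn p[OF zeroL] by simp
  qed (use y2'' y0 rayleigh \<gamma> in \<open>simp_all add: interface_profile_def\<close>)
qed

text \<open>The witnesses are forced: \<open>y1\<close> solves the incompressibility condition and
  \<open>p\<close> the horizontal momentum equation.\<close>

lemma reduced_imp_mode_system:
  assumes "reduced_system g \<sigma> \<rho> h U k c \<zeta> y2 \<gamma>"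
  shows "mode_system g \<sigma> \<rho> h U k c \<zeta> (\<lambda>s x. \<i> / of_int k * der (L s) (y2 s) x) y2 \<gamma>
    (\<lambda>s. mode_pressure k c (L s) (U s) (y2 s) (\<gamma> s))"
proof -
  note sys = assms[unfolded reduced_system_def Let_def]
  have \<gamma>: "\<forall>x\<in>L s. \<gamma> s x = interface_profile \<rho> h U k \<zeta> s x" for s
    unfolding interface_profile_def using sys by blast
  note prof = interface_profile_properties[of \<rho> h k _ "\<gamma> _", OF \<rho> h k \<gamma>]
  have y2: "C2_on (L s) (y2 s)" and wall: "y2 s (wall h s) = 0" and y0: "y2 Upper 0 = y2 Lower 0"
    and kin: "\<i> * of_int k * (of_real ((\<rho> Upper * U Upper 0 * tanh (\<bar>real_of_int k\<bar> * h Lower)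
          + \<rho> Lower * U Lower 0 * tanh (\<bar>real_of_int k\<bar> * h Upper)) / tanh_denominator \<rho> h k) - c) * \<zeta> = y2 Upper 0"
    and ray: "x \<in> open_layer h s \<Longrightarrow> rayleigh_at (L s) (U s) k c (y2 s) (\<gamma> s) x" for s x
    using sys by blast+
  have diff: "y2 s differentiable_on L s" "der (L s) (y2 s) differentiable_on L s" "\<gamma> s differentiable_on L s"
    "der (L s) (\<gamma> s) differentiable_on L s" "continuous_on (L s) (der (L s) (der (L s) (y2 s)))" for s
    using y2[of s] prof(1)[of s] by (auto simp: C2_on_def)
  have cont: "continuous_on (L s) (y2 s)" "continuous_on (L s) (der (L s) (y2 s))" "continuous_on (L s) (\<gamma> s)"
    "continuous_on (L s) (der (L s) (\<gamma> s))" "continuous_on (L s) (der (L s) (der (L s) (y2 s)))" for s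
    using diff[of s] by (auto intro: differentiable_imp_continuous_on)
  let ?p = "\<lambda>s. mode_pressure k c (L s) (U s) (y2 s) (\<gamma> s)"
  have R: "(of_real (U s x) - c) * (of_int k ^ 2 * y2 s x - der (L s) (der (L s) (y2 s)) x)
         + of_real (der (L s) (der (L s) (U s)) x) * (y2 s x + der (L s) (\<gamma> s) x) = 0" if "x \<in> L s" for s x
    by (rule eq_on_closed_layer[of h s, OF h _ _ ray[unfolded rayleigh_at_iff] that])
      (intro continuous_intros cont cont_U U_diff(3))+
  \<comment> \<open>As \<open>mode_pressure\<close> contains \<open>y2'\<close> and
    \<open>y2\<close> is only twice differentiable, a second derivative of the pressure is not
    evident. The Rayleigh equation removes \<open>y2''\<close> from \<open>p'\<close>, which can
    then be differentiated once more.\<close>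
  define p' where "p' s x = - \<i> * of_int k * ((of_real (U s x) - c) * y2 s x + of_real (U s x) * der (L s) (\<gamma> s) x)" for s x
  have dp: "(?p s has_vector_derivative p' s x) (at x within L s)" if "x \<in> L s" for s x
    using mode_pressure_deriv[OF k U_diff(1,2) y2 prof(1) prof(2)[OF that] that, of c]
    unfolding R[OF that] by (simp add: p'_def)
  then have p': "der (L s) (?p s) x = p' s x" if "x \<in> L s" for s x
    using that lim by (blast intro: der_eq)
  define p'' where "p'' s x = - \<i> * of_int k * (of_real (der (L s) (U s) x) * (y2 s x + der (L s) (\<gamma> s) x)
      + (of_real (U s x) - c) * der (L s) (y2 s) x + of_real (U s x) * (of_int k ^ 2 * \<gamma> s x))" for s x
  have ddp: "(der (L s) (?p s) has_vector_derivative p'' s x) (at x within L s)" if x: "x \<in> L s" for s x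
  proof (rule has_vector_derivative_transform[OF x p'])
    have d: "(y2 s has_vector_derivative der (L s) (y2 s) x) (at x within L s)"
      "(der (L s) (\<gamma> s) has_vector_derivative of_int k ^ 2 * \<gamma> s x) (at x within L s)"
      "((\<lambda>x. complex_of_real (U s x)) has_vector_derivative of_real (der (L s) (U s) x)) (at x within L s)"
      using has_der[OF diff(1) x] has_der[OF diff(4) x] prof(2)[OF x] has_der_of_real[OF U_diff(1) x] by simp_all
    show "(p' s has_vector_derivative p'' s x) (at x within L s)"
      unfolding p'_def[abs_def]
      by (rule has_vector_derivative_eq_rhs, (rule derivative_intros d)+) (simp add: p''_def algebra_simps)
  qed
  then have p'': "der (L s) (der (L s) (?p s)) x = p'' s x" if "x \<in> L s" for s x
    using that lim by (blast intro: der_eq)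
  have "continuous_on (L s) (p'' s)" for s
    unfolding p''_def[abs_def] by (intro continuous_intros cont cont_U)
  then have C2p: "C2_on (L s) (?p s)" for s
    unfolding C2_on_def differentiable_on_def
    using differentiableI_vector[OF dp] differentiableI_vector[OF ddp] p'' by (simp cong: continuous_on_cong)
  have y1: "Cn 1 (L s) (\<lambda>x. \<i> / of_int k * der (L s) (y2 s) x)" for s
    by (rule Cn_cmult[OF lim]) (simp_all only: Cn_1 diff simp_thms)
  have div: "\<i> * of_int k * (\<i> / of_int k * der (L s) (y2 s) x) + der (L s) (y2 s) x = 0" for s x
    using k by simp
  have kin': "\<i> * of_int k * (of_real (U s 0) - c) * \<zeta> = y2 s 0 + der (L s) (\<gamma> s) 0" for s
  proof -
    have "y2 s 0 = y2 Upper 0" using y0 by (cases s) simp_all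
    then show ?thesis
      using prof(4)[of s] kin by (simp add: algebra_simps)
  qed
  have "of_real (\<rho> Upper) * \<gamma> Upper 0 = of_real (\<rho> Lower) * \<gamma> Lower 0"
    using interface_profile_balance[of \<rho> h k U \<zeta>, OF \<rho> h k] bspec[OF \<gamma> zeroL] by simp
  note jump = mode_pressure_jump[of k y2 \<rho> \<gamma> c "closed_layer h" U, OF k y0 this]
  show ?thesis
    unfolding mode_system_def Let_def
  proof (intro conjI allI ballI)
    fix s
    show "Cn 1 (L s) (\<lambda>x. \<i> / of_int k * der (L s) (y2 s) x)" by (rule y1)
    show "Cn 1 (L s) (y2 s)" by (simp only: Cn_1 diff(1) cont(2) simp_thms)
    show "Cn 2 (L s) (\<gamma> s)" "Cn 2 (L s) (?p s)" using prof(1) C2p by (simp_all add: Cn_2)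
    show "y2 s (wall h s) = 0" by (rule wall)
    show "der (L s) (\<gamma> s) (wall h s) = 0" by (rule prof(3))
    \<comment> \<open>Both \<open>y2\<close> and \<open>\<gamma>'\<close> vanish at the wall, and
      every term of \<open>p'\<close> contains one of them.\<close>
    then show "der (L s) (?p s) (wall h s) = 0"
      using p'[OF wallL] wall by (simp add: p'_def)
    show "\<i> * of_int k * (of_real (U s 0) - c) * \<zeta> = y2 s 0 + der (L s) (\<gamma> s) 0" by (rule kin')
    show "\<gamma> s 0 = of_real ((U Lower 0 - U Upper 0) / \<rho> s) *
       (\<i> * of_int k * of_real (inverse (N_symbol \<rho> h k)) * \<zeta>)"
      using bspec[OF \<gamma> zeroL] interface_profile_at_0[of \<rho> h k U \<zeta> s, OF \<rho> h k] by simp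
    fix x assume "x \<in> open_layer h s"
    then have x: "x \<in> L s" by (rule open_subset_closed_layer)
    show "\<i> * of_int k * (\<i> / of_int k * der (L s) (y2 s) x) + der (L s) (y2 s) x = 0" by (rule div)
    show "\<i> * of_int k * ((of_real (U s x) - c) * (\<i> / of_int k * der (L s) (y2 s) x) + of_real (U s x) * (\<i> * of_int k) * \<gamma> s x)
        + of_real (der (L s) (U s) x) * (y2 s x + der (L s) (\<gamma> s) x) + \<i> * of_int k * ?p s x = 0"
      using mode_pressure_momentum[OF k div] by blast
    show "\<i> * of_int k * ((of_real (U s x) - c) * y2 s x + of_real (U s x) * der (L s) (\<gamma> s) x) + der (L s) (?p s) x = 0"
      unfolding p'[OF x] by (simp add: p'_def)
    show "der (L s) (der (L s) (\<gamma> s)) x = of_int k ^ 2 * \<gamma> s x" by (rule prof(2)[OF x])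
    \<comment> \<open>The terms in \<open>(U - c) y2'\<close> and in \<open>U \<gamma>\<close>
      cancel between \<open>k^2 p\<close> and \<open>p''\<close>; those in \<open>U'\<close> add up,
      which gives the factor 2.\<close>
    show "of_int k ^ 2 * ?p s x - der (L s) (der (L s) (?p s)) x
      = 2 * of_real (der (L s) (U s) x) * (\<i> * of_int k) * (y2 s x + der (L s) (\<gamma> s) x)"
      unfolding p''[OF x] using k by (simp add: p''_def mode_pressure_def field_simps power2_eq_square)
  next
    show "of_real (\<rho> Upper) * ?p Upper 0 - of_real (\<rho> Lower) * ?p Lower 0 =
      of_real (g * jump \<rho> - \<sigma> * real_of_int k ^ 2) * \<zeta>"
      using jump sys by simp
  qed (rule y0)
qed

text \<open>What remains is nontriviality: if \<open>\<zeta>\<close>, \<open>y2\<close> and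
  \<open>\<gamma>\<close> vanish, so do the amplitudes \<open>y1\<close> and \<open>p\<close>
  determined by them.\<close>

lemma is_eigenvalue_iff_reduced:
  "is_eigenvalue g \<sigma> \<rho> h U k (- \<i> * of_int k * c) \<longleftrightarrow>
    (\<exists>\<zeta> y2 \<gamma>. reduced_system g \<sigma> \<rho> h U k c \<zeta> y2 \<gamma> \<and> nontrivial_reduced h \<zeta> y2 \<gamma>)"
proof -
  have nontrivial: "nontrivial_fields h (\<lambda>t x1. \<zeta> * mode_factor k c t x1)
      (mode_field k c y1) (mode_field k c y2) (mode_field k c \<gamma>) (mode_field k c p)
    \<longleftrightarrow> \<zeta> \<noteq> 0 \<or> (\<exists>s. \<exists>x\<in>L s. y1 s x \<noteq> 0 \<or> y2 s x \<noteq> 0 \<or> \<gamma> s x \<noteq> 0 \<or> p s x \<noteq> 0)" for \<zeta> y1 y2 \<gamma> p c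
    by (simp add: nontrivial_fields_def mode_field_def)
  \<comment> \<open>The definition of an eigenvalue quantifies over the wave speed; as
    \<open>k\<close> is nonzero, the eigenvalue determines it.\<close>
  have "- \<i> * of_int k * c = - \<i> * of_int k * c' \<longleftrightarrow> c' = c" for c'
    using k by auto
  then have "is_eigenvalue g \<sigma> \<rho> h U k (- \<i> * of_int k * c) \<longleftrightarrow>
    (\<exists>\<zeta> y1 y2 \<gamma> p. mode_system g \<sigma> \<rho> h U k c \<zeta> y1 y2 \<gamma> p \<and>
      (\<zeta> \<noteq> 0 \<or> (\<exists>s. \<exists>x\<in>L s. y1 s x \<noteq> 0 \<or> y2 s x \<noteq> 0 \<or> \<gamma> s x \<noteq> 0 \<or> p s x \<noteq> 0)))"
    unfolding is_eigenvalue_def Let_def nontrivial linearized_euler_mode_iff[of h, OF h] by simp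
  also have "\<dots> \<longleftrightarrow> (\<exists>\<zeta> y2 \<gamma>. reduced_system g \<sigma> \<rho> h U k c \<zeta> y2 \<gamma> \<and> nontrivial_reduced h \<zeta> y2 \<gamma>)"
  proof (intro iffI; elim exE conjE)
    fix \<zeta> y1 y2 \<gamma> p
    assume sys: "mode_system g \<sigma> \<rho> h U k c \<zeta> y1 y2 \<gamma> p"
      and non: "\<zeta> \<noteq> 0 \<or> (\<exists>s. \<exists>x\<in>L s. y1 s x \<noteq> 0 \<or> y2 s x \<noteq> 0 \<or> \<gamma> s x \<noteq> 0 \<or> p s x \<noteq> 0)"
    have "nontrivial_reduced h \<zeta> y2 \<gamma>"
    proof (rule ccontr)
      assume "\<not> nontrivial_reduced h \<zeta> y2 \<gamma>"
      then have zero: "\<zeta> = 0" "\<And>s x. x \<in> L s \<Longrightarrow> y2 s x = 0" "\<And>s x. x \<in> L s \<Longrightarrow> \<gamma> s x = 0"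
        by (auto simp: nontrivial_reduced_def)
      have "der (L s) f x = 0" if "\<And>x. x \<in> L s \<Longrightarrow> f x = 0" "x \<in> L s" for s x and f :: "real \<Rightarrow> complex"
        using der_cong[of "L s" f "\<lambda>_. 0" x] der_eq[of "\<lambda>_. 0" 0 x "L s"] that lim[of x s] by simp
      then have "der (L s) (y2 s) x = 0" "der (L s) (\<gamma> s) x = 0" if "x \<in> L s" for s x
        using that zero by blast+
      then have "y1 s x = 0" "p s x = 0" if "x \<in> L s" for s x
        using mode_system_imp_reduced(2,3)[OF sys that] that zero k by (simp_all add: mode_pressure_def)
      then show False
        using non zero by blast
    qed
    then show "\<exists>\<zeta> y2 \<gamma>. reduced_system g \<sigma> \<rho> h U k c \<zeta> y2 \<gamma> \<and> nontrivial_reduced h \<zeta> y2 \<gamma>"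
      using mode_system_imp_reduced(1)[OF sys] by blast
  next
    fix \<zeta> y2 \<gamma>
    assume "reduced_system g \<sigma> \<rho> h U k c \<zeta> y2 \<gamma>" "nontrivial_reduced h \<zeta> y2 \<gamma>"
    from reduced_imp_mode_system[OF this(1)] this(2)
    show "\<exists>\<zeta> y1 y2 \<gamma> p. mode_system g \<sigma> \<rho> h U k c \<zeta> y1 y2 \<gamma> p \<and>
      (\<zeta> \<noteq> 0 \<or> (\<exists>s. \<exists>x\<in>L s. y1 s x \<noteq> 0 \<or> y2 s x \<noteq> 0 \<or> \<gamma> s x \<noteq> 0 \<or> p s x \<noteq> 0))"
      unfolding nontrivial_reduced_def by blast
  qed
  finally show ?thesis .
qed

end

theorem proposition2p1:
  fixes g \<sigma> :: real
    and \<rho> h :: "side \<Rightarrow> real"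
    and U :: "side \<Rightarrow> real \<Rightarrow> real"
    and k :: int
    and c :: complex
  assumes "g > 0"
    and "\<sigma> \<ge> 0"
    and "\<And>s. \<rho> s > 0"
    and "\<And>s. h s > 0"
    and "\<And>s. smooth_on (closed_layer h s) (U s)"
    and "k \<noteq> 0"
  shows "is_eigenvalue g \<sigma> \<rho> h U k (- \<i> * of_int k * c) \<longleftrightarrow>
    (\<exists>\<zeta> y2 \<gamma>. reduced_system g \<sigma> \<rho> h U k c \<zeta> y2 \<gamma> \<and> nontrivial_reduced h \<zeta> y2 \<gamma>)"
  using assms(3-6) by (rule is_eigenvalue_iff_reduced)

end
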